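(* Let $L$ be a (non-degenerate) integral lattice of finite rank with a chosen ordered $\mathbb{Z}$-basis $\{\varepsilon_i\}$, let $P$ (respectively $N$) be the set of non-negative (respectively strictly negative) rational combinations of the $\varepsilon_i$, let $D=P\cup N$ and $D(L)=D\cap L$, and let $V_{D(L)}=V_{P(L)}\oplus V_{N(L)}\subset V_L$, $\widetilde Y$, $\mathbf{v}=1\otimes\mathbf{v}_0$ and $\omega$ be as defined in the context. Then the four-tuple $(V_{D(L)},\widetilde Y,\mathbf{v},\omega)$ is a conformal super vertex algebra. It is a super vertex operator algebra if $D$ has no non-trivial vectors of non-positive length squared (i.e. no $0\ne\lambda\in D$ with $\langle\lambda,\lambda\rangle\le0$).
   Context: **Lattice super vertex algebra.** The bilinear form $\langle\cdot,\cdot\rangle$ on $L$ need not be positive-definite. Let $\mathfrak{h}=L\otimes_{\mathbb{Z}}\mathbb{C}$ with the form extended $\mathbb{C}$-bilinearly, and $\hat{\mathfrak{h}}=\mathfrak{h}[t,t^{-1}]\oplus\mathbb{C}\mathbf{c}$ with $\mathbf{c}$ central and $[u(m),v(n)]=m\langle u,v\rangle\delta_{m+n,0}\mathbf{c}$, where $u(m)=u\otimes t^m$. Put $\hat{\mathfrak{h}}^\pm=\mathfrak{h}[t^{\pm1}]t^{\pm1}$, $\hat{\mathfrak{h}}^0=\mathfrak{h}\oplus\mathbb{C}\mathbf{c}$. Let $b:L\times L\to\mathbb{Z}/2\mathbb{Z}$ be a bilinear function with $b(\lambda,\mu)+b(\mu,\lambda)=\langle\lambda,\mu\rangle+\langle\lambda,\lambda\rangle\langle\mu,\mu\rangle+2\mathbb{Z}$,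 and $\beta=(-1)^b$. Let $\mathbb{C}_\beta[L]$ be the algebra with basis $\mathbf{v}_\lambda$, $\lambda\in L$, and $\mathbf{v}_\lambda\mathbf{v}_\mu=\beta(\lambda,\mu)\mathbf{v}_{\lambda+\mu}$; it is an $\hat{\mathfrak{h}}^0\oplus\hat{\mathfrak{h}}^+$-module via $\mathbf{c}\mathbf{v}_\lambda=\mathbf{v}_\lambda$, $u(m)\mathbf{v}_\lambda=\delta_{m,0}\langle u,\lambda\rangle\mathbf{v}_\lambda$ ($m\ge0$). Let $V_L=U(\hat{\mathfrak{h}})\otimes_{U(\hat{\mathfrak{h}}^0\oplus\hat{\mathfrak{h}}^+)}\mathbb{C}_\beta[L]\simeq S(\hat{\mathfrak{h}}^-)\otimes\mathbb{C}[L]$. It carries a unique super vertex algebra structure $Y$ with vacuum $1\otimes\mathbf{v}_0$ (the parity of $f\otimes\mathbf{v}_\lambda$ being that of $\langle\lambda,\lambda\rangle$), such that $Y(u(-1)\otimes\mathbf{v}_0,z)=\sum_{n\in\mathbb{Z}}u(n)z^{-n-1}$ for $u\in\mathfrak{h}$ and $$Y(1\otimes\mathbf{v}_\lambda,z)=\exp\Big(-\sum_{n<0}\tfrac{\lambda(n)}{n}z^{-n}\Big)\exp\Big(-\sum_{n>0}\tfrac{\lambda(n)}{n}z^{-n}\Big)\mathbf{v}_\lambda z^{\lambda(0)}$$ for $\lambda\in L$, where $\mathbf{v}_\lambda(f\otimes\mathbf{v}_\mu)=\beta(\lambda,\mu)f\otimes\mathbf{v}_{\lambda+\mu}$ and $z^{\lambda(0)}(f\otimes\mathbf{v}_\mu)=z^{\langle\lambda,\mu\rangle}f\otimes\mathbf{v}_\mu$.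 The conformal element is $\omega=\frac12\sum_i\varepsilon_i'(-1)\varepsilon_i(-1)\otimes\mathbf{v}_0$, where $\varepsilon_i'\in L\otimes\mathbb{Q}$ satisfy $\langle\varepsilon_i',\varepsilon_j\rangle=\delta_{ij}$. Let $\theta$ be the involutive automorphism of $V_L$ given by $\theta(f\otimes\mathbf{v}_\lambda)=(-1)^kf\otimes\mathbf{v}_{-\lambda}$ for $f\in S(\hat{\mathfrak{h}}^-)$ homogeneous of degree $k$ in the variables $u(-m)$. **Cone construction.** $P=\{\sum_i\alpha_i\varepsilon_i\in L\otimes\mathbb{Q}:\alpha_i\ge0\ \forall i\}$, $N=\{\sum_i\alpha_i\varepsilon_i\in L\otimes\mathbb{Q}:\alpha_i<0\ \forall i\}$, $P(L)=P\cap L$, $N(L)=N\cap L$. For $K\subset L$, $V_K\simeq S(\hat{\mathfrak{h}}^-)\otimes\mathbb{C}[K]$ is the $\hat{\mathfrak{h}}$-submodule of $V_L$ generated by the $\mathbf{v}_\lambda$, $\lambda\in K$. Define $\widetilde Y:V_{D(L)}\otimes V_{D(L)}\to V_{D(L)}((z))$ bilinearly by $$\widetilde Y(a,z)b=\begin{cases}Y(a,z)b,&a,b\in V_{P(L)},\\ Y(\theta a,z)b,&a\in V_{P(L)},\ b\in V_{N(L)},\\ Y(a,z)\theta b,&a\in V_{N(L)},\ b\in V_{P(L)},\\ \theta Y(a,z)b,&a,b\in V_{N(L)}.\end{cases}$$ **Terminology.** A conformal super vertex algebra is a super vertex algebra with a conformal (Virasoro) element $\omega$: the modes in $\widetilde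 Y(\omega,z)=\sum L(n)z^{-n-2}$ satisfy the Virasoro relations, $L(-1)$ is the translation operator, and $L(0)$ is diagonalizable. It is a super vertex operator algebra if in addition the $L(0)$-eigenvalues lie in $\frac12\mathbb{Z}$ and are bounded below, and the $L(0)$-eigenspaces are finite-dimensional. *)

theory Defs
  imports
    "HOL-Analysis.Finite_Cartesian_Product"
    "HOL-Library.Poly_Mapping"
    "HOL-Library.Multiset"
    "HOL-Library.Z2"
begin

section \<open>Conformal super vertex algebras\<close>

definition bit_sign :: "bit \<Rightarrow> complex"
  where "bit_sign p = (if p = 0 then 1 else -1)"

text \<open>
  \<open>V p\<close> is the subspace of vectors of parity \<open>p\<close>, and \<open>Y a n b\<close> is the mode \<open>a\<^sub>(\<^sub>n\<^sub>) b\<close>, that is, the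
  coefficient of \<open>z\<close> to the power \<open>- n - 1\<close> in \<open>Y(a,z) b\<close>. The values of \<open>Y\<close> matter on
  \<open>super_space V\<close> only. The sums over \<open>i\<close> in the Borcherds (Jacobi) identity have finite support by \<open>truncation\<close>.
\<close>

definition super_space :: "(bit \<Rightarrow> 'v::plus set) \<Rightarrow> 'v set"
  where "super_space V = {a + b | a b. a \<in> V 0 \<and> b \<in> V 1}"

definition vir_mode :: "('v \<Rightarrow> int \<Rightarrow> 'v \<Rightarrow> 'v) \<Rightarrow> 'v \<Rightarrow> int \<Rightarrow> 'v \<Rightarrow> 'v"
  where "vir_mode Y \<omega> n v = Y \<omega> (n + 1) v"

locale super_vertex_algebra = vector_space scale
  for scale :: "complex \<Rightarrow> 'v::ab_group_add \<Rightarrow> 'v" +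
  fixes V :: "bit \<Rightarrow> 'v set"
    and Y :: "'v \<Rightarrow> int \<Rightarrow> 'v \<Rightarrow> 'v"
    and vac :: 'v
  assumes subspace_V: "subspace (V p)"
    and direct: "V 0 \<inter> V 1 = {0}"
    and add_left: "\<lbrakk>a \<in> super_space V; b \<in> super_space V; c \<in> super_space V\<rbrakk> \<Longrightarrow> Y (a + b) n c = Y a n c + Y b n c"
    and add_right: "\<lbrakk>a \<in> super_space V; b \<in> super_space V; c \<in> super_space V\<rbrakk> \<Longrightarrow> Y a n (b + c) = Y a n b + Y a n c"
    and scale_left: "\<lbrakk>a \<in> super_space V; b \<in> super_space V\<rbrakk> \<Longrightarrow> Y (scale r a) n b = scale r (Y a n b)"
    and scale_right: "\<lbrakk>a \<in> super_space V; b \<in> super_space V\<rbrakk> \<Longrightarrow> Y a n (scale r b) = scale r (Y a n b)"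
    and parity: "\<lbrakk>a \<in> V p; b \<in> V q\<rbrakk> \<Longrightarrow> Y a n b \<in> V (p + q)"
    and truncation: "\<lbrakk>a \<in> super_space V; b \<in> super_space V\<rbrakk> \<Longrightarrow> \<exists>N. \<forall>n\<ge>N. Y a n b = 0"
    and vac_even: "vac \<in> V 0"
    and vac_left: "a \<in> super_space V \<Longrightarrow> Y vac n a = (if n = -1 then a else 0)"
    and creation: "a \<in> super_space V \<Longrightarrow> Y a (-1) vac = a"
    and creation_nonneg: "\<lbrakk>a \<in> super_space V; 0 \<le> n\<rbrakk> \<Longrightarrow> Y a n vac = 0"
    and borcherds: "\<lbrakk>a \<in> V p; b \<in> V q; c \<in> super_space V\<rbrakk> \<Longrightarrow>
      Sum_any (\<lambda>i::nat. scale (of_int m gchoose i) (Y (Y a (n + int i) b) (m + k - int i) c)) =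
      Sum_any (\<lambda>i::nat. scale ((-1) ^ i * (of_int n gchoose i))
        (Y a (m + n - int i) (Y b (k + int i) c)
          - scale ((-1) powi n * bit_sign (p * q)) (Y b (n + k - int i) (Y a (m + int i) c))))"

text \<open>
  The translation operator of a super vertex algebra sends \<open>a\<close> to \<open>a\<^sub>(\<^sub>-\<^sub>2\<^sub>) vac\<close>.
\<close>

locale conformal_super_vertex_algebra = super_vertex_algebra scale V Y vac
  for scale :: "complex \<Rightarrow> 'v::ab_group_add \<Rightarrow> 'v" and V Y vac +
  fixes \<omega> :: 'v
  assumes conformal_even: "\<omega> \<in> V 0"
    and virasoro: "\<exists>c. \<forall>m n. \<forall>v\<in>super_space V.
      vir_mode Y \<omega> m (vir_mode Y \<omega> n v) - vir_mode Y \<omega> n (vir_mode Y \<omega> m v) =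
        scale (of_int (m - n)) (vir_mode Y \<omega> (m + n) v)
        + (if m + n = 0 then scale (of_int (m ^ 3 - m) / 12 * c) v else 0)"
    and translation: "a \<in> super_space V \<Longrightarrow> vir_mode Y \<omega> (-1) a = Y a (-2) vac"
    and diagonalizable: "super_space V \<subseteq> span {v \<in> super_space V. \<exists>h. vir_mode Y \<omega> 0 v = scale h v}"

locale super_vertex_operator_algebra = conformal_super_vertex_algebra scale V Y vac \<omega>
  for scale :: "complex \<Rightarrow> 'v::ab_group_add \<Rightarrow> 'v" and V Y vac \<omega> +
  assumes half_integral:
      "\<lbrakk>v \<in> super_space V; v \<noteq> 0; vir_mode Y \<omega> 0 v = scale h v\<rbrakk> \<Longrightarrow> \<exists>k::int. h = of_int k / 2"
    and bounded_below:
      "\<exists>r::real. \<forall>v\<in>super_space V. \<forall>h. v \<noteq> 0 \<and> vir_mode Y \<omega> 0 v = scale h v \<longrightarrow> r \<le> Re h"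
    and finite_dimensional:
      "\<exists>F. finite F \<and> {v \<in> super_space V. vir_mode Y \<omega> 0 v = scale h v} \<subseteq> span F"


section \<open>Integral lattices with a chosen basis\<close>

text \<open>
  The chosen basis identifies \<open>L\<close> with \<open>int ^ 'n\<close>, the basis vector \<open>\<epsilon>\<^sub>i\<close> being \<open>axis i 1\<close>. Accordingly
  \<open>L \<otimes> \<rat>\<close> is \<open>rat ^ 'n\<close> and \<open>L \<otimes> \<complex>\<close> is \<open>complex ^ 'n\<close>.
\<close>

definition nondegenerate_integral_lattice :: "(int ^ 'n \<Rightarrow> int ^ 'n \<Rightarrow> int) \<Rightarrow> bool"
  where "nondegenerate_integral_lattice B \<longleftrightarrow>
    (\<forall>x y z. B (x + y) z = B x z + B y z) \<and>
    (\<forall>x y. B x y = B y x) \<and>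
    (\<forall>x. (\<forall>y. B x y = 0) \<longrightarrow> x = 0)"

definition lattice_vec :: "int ^ 'n \<Rightarrow> 'a::ring_1 ^ 'n"
  where "lattice_vec \<alpha> = (\<chi> i. of_int (\<alpha> $ i))"

definition form_ext :: "(int ^ 'n \<Rightarrow> int ^ 'n \<Rightarrow> int) \<Rightarrow> 'a::comm_ring_1 ^ 'n \<Rightarrow> 'a ^ 'n \<Rightarrow> 'a"
  where "form_ext B u v =
    (\<Sum>i\<in>UNIV. \<Sum>j\<in>UNIV. u $ i * v $ j * of_int (B (axis i 1) (axis j 1)))"

definition dual_basis :: "(int ^ 'n \<Rightarrow> int ^ 'n \<Rightarrow> int) \<Rightarrow> 'n \<Rightarrow> rat ^ 'n"
  where "dual_basis B i = (THE u. \<forall>j. form_ext B u (axis j 1) = (if i = j then 1 else 0))"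

text \<open>The exponent \<open>b\<close> of the sign cocycle, with values in \<open>\<int>/2\<int>\<close>.\<close>

definition lattice_cocycle ::
    "(int ^ 'n \<Rightarrow> int ^ 'n \<Rightarrow> int) \<Rightarrow> (int ^ 'n \<Rightarrow> int ^ 'n \<Rightarrow> bit) \<Rightarrow> bool"
  where "lattice_cocycle B b \<longleftrightarrow>
    (\<forall>\<alpha> \<mu> \<nu>. b (\<alpha> + \<mu>) \<nu> = b \<alpha> \<nu> + b \<mu> \<nu>) \<and>
    (\<forall>\<alpha> \<mu> \<nu>. b \<alpha> (\<mu> + \<nu>) = b \<alpha> \<mu> + b \<alpha> \<nu>) \<and>
    (\<forall>\<alpha> \<mu>. b \<alpha> \<mu> + b \<mu> \<alpha> = of_int (B \<alpha> \<mu> + B \<alpha> \<alpha> * B \<mu> \<mu>))"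


section \<open>The space of the lattice super vertex algebra\<close>

text \<open>
  The induced module \<open>V\<^sub>L\<close> is realised on its Poincare-Birkhoff-Witt basis, i.e. as the tensor product
  of the symmetric algebra of the negative half of the Heisenberg algebra with the span of the
  \<open>v\<^sub>\<alpha>\<close>. The index \<open>(s, \<alpha>)\<close> stands for the product of the \<open>\<epsilon>\<^sub>i(- Suc k)\<close> over all \<open>(i, k)\<close> in the
  multiset \<open>s\<close> (note the shift, as only negative modes occur), tensored with \<open>v\<^sub>\<alpha>\<close>.
\<close>

type_synonym 'n fock_index = "('n \<times> nat) multiset \<times> (int ^ 'n)"
type_synonym 'n fock = "'n fock_index \<Rightarrow>\<^sub>0 complex"

definition fock_scale :: "complex \<Rightarrow> 'n fock \<Rightarrow> 'n fock"
  where "fock_scale c v = Poly_Mapping.map (\<lambda>x. c * x) v"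

definition fock_basis :: "'n fock_index \<Rightarrow> 'n fock"
  where "fock_basis x = Poly_Mapping.single x 1"

definition lin_ext :: "('n fock_index \<Rightarrow> 'n fock) \<Rightarrow> 'n fock \<Rightarrow> 'n fock"
  where "lin_ext f v = (\<Sum>x\<in>Poly_Mapping.keys v. fock_scale (Poly_Mapping.lookup v x) (f x))"

definition fock_exp :: "int ^ 'n \<Rightarrow> 'n fock"
  where "fock_exp \<alpha> = fock_basis ({#}, \<alpha>)"

definition fock_vac :: "'n::finite fock"
  where "fock_vac = fock_exp 0"

text \<open>The subspace \<open>V\<^sub>K\<close> spanned by the \<open>f \<otimes> v\<^sub>\<alpha>\<close> with \<open>\<alpha> \<in> K\<close>, and the projection onto it that kills the
  \<open>f \<otimes> v\<^sub>\<alpha>\<close> with \<open>\<alpha> \<notin> K\<close>.\<close>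

definition fock_supported :: "(int ^ 'n) set \<Rightarrow> 'n fock set"
  where "fock_supported K = {v. \<forall>(s, \<alpha>) \<in> Poly_Mapping.keys v. \<alpha> \<in> K}"

definition fock_proj :: "(int ^ 'n) set \<Rightarrow> 'n fock \<Rightarrow> 'n fock"
  where "fock_proj K = lin_ext (\<lambda>(s, \<alpha>). if \<alpha> \<in> K then fock_basis (s, \<alpha>) else 0)"

definition fock_parity :: "(int ^ 'n \<Rightarrow> int ^ 'n \<Rightarrow> int) \<Rightarrow> bit \<Rightarrow> 'n fock set"
  where "fock_parity B p = fock_supported {\<alpha>. of_int (B \<alpha> \<alpha>) = p}"

text \<open>
  The operator \<open>u(m)\<close>. A negative mode multiplies by the variable \<open>u(m)\<close>; a positive mode is the
  derivation that annihilates the \<open>v\<^sub>\<mu>\<close> and sends \<open>\<epsilon>\<^sub>i(-m)\<close> to \<open>m \<langle>u, \<epsilon>\<^sub>i\<rangle>\<close>.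
\<close>

definition heis :: "(int ^ 'n \<Rightarrow> int ^ 'n \<Rightarrow> int) \<Rightarrow> complex ^ 'n \<Rightarrow> int \<Rightarrow> 'n fock \<Rightarrow> 'n fock"
  where "heis B u m = lin_ext (\<lambda>(s, \<mu>).
    if m < 0 then
      \<Sum>i\<in>UNIV. fock_scale (u $ i) (fock_basis (add_mset (i, nat (- m - 1)) s, \<mu>))
    else if m = 0 then
      fock_scale (form_ext B u (lattice_vec \<mu>)) (fock_basis (s, \<mu>))
    else
      \<Sum>i\<in>UNIV. fock_scale
        (of_nat (count s (i, nat (m - 1))) * (of_int m * form_ext B u (axis i 1)))
        (fock_basis (s - {#(i, nat (m - 1))#}, \<mu>)))"

definition exp_mult :: "(int ^ 'n \<Rightarrow> int ^ 'n \<Rightarrow> bit) \<Rightarrow> int ^ 'n \<Rightarrow> 'n fock \<Rightarrow> 'n fock"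
  where "exp_mult b \<alpha> = lin_ext (\<lambda>(s, \<mu>). fock_scale (bit_sign (b \<alpha> \<mu>)) (fock_basis (s, \<alpha> + \<mu>)))"

text \<open>\<open>series_power A j k\<close> and \<open>series_exp A k\<close> are the coefficients of \<open>x ^ k\<close> in the \<open>j\<close>-th power and
  in the exponential of the formal series \<open>\<Sum>m\<ge>1. A m x ^ m\<close> with operator coefficients.\<close>

primrec series_power :: "(nat \<Rightarrow> 'n fock \<Rightarrow> 'n fock) \<Rightarrow> nat \<Rightarrow> nat \<Rightarrow> 'n fock \<Rightarrow> 'n fock"
  where
    "series_power A 0 k v = (if k = 0 then v else 0)"
  | "series_power A (Suc j) k v = (\<Sum>m=1..k. A m (series_power A j (k - m) v))"

definition series_exp :: "(nat \<Rightarrow> 'n fock \<Rightarrow> 'n fock) \<Rightarrow> nat \<Rightarrow> 'n fock \<Rightarrow> 'n fock"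
  where "series_exp A k v = (\<Sum>j\<le>k. fock_scale (1 / fact j) (series_power A j k v))"

text \<open>
  \<open>exp_neg B \<alpha> k\<close> is the coefficient of \<open>z ^ k\<close> in \<open>exp (- \<Sum>n<0. \<alpha>(n) / n z powi (- n))\<close>, and
  \<open>exp_pos B \<alpha> k\<close> is that of \<open>z powi (- k)\<close> in \<open>exp (- \<Sum>n>0. \<alpha>(n) / n z powi (- n))\<close>.
\<close>

definition exp_neg :: "(int ^ 'n \<Rightarrow> int ^ 'n \<Rightarrow> int) \<Rightarrow> int ^ 'n \<Rightarrow> nat \<Rightarrow> 'n fock \<Rightarrow> 'n fock"
  where "exp_neg B \<alpha> =
    series_exp (\<lambda>m v. fock_scale (- (1 / (- of_nat m))) (heis B (lattice_vec \<alpha>) (- int m) v))"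

definition exp_pos :: "(int ^ 'n \<Rightarrow> int ^ 'n \<Rightarrow> int) \<Rightarrow> int ^ 'n \<Rightarrow> nat \<Rightarrow> 'n fock \<Rightarrow> 'n fock"
  where "exp_pos B \<alpha> =
    series_exp (\<lambda>m v. fock_scale (- (1 / of_nat m)) (heis B (lattice_vec \<alpha>) (int m) v))"

text \<open>
  The mode of index \<open>n\<close>, i.e. the coefficient of \<open>z powi (- n - 1)\<close>, of the vertex operator attached to
  \<open>v\<^sub>\<alpha>\<close>. On \<open>f \<otimes> v\<^sub>\<mu>\<close> the factor \<open>z powi \<alpha>(0)\<close> contributes \<open>z powi (B \<alpha> \<mu>)\<close>, so that the coefficients
  \<open>exp_neg B \<alpha> k\<close> and \<open>exp_pos B \<alpha> l\<close> are combined for \<open>k - l + B \<alpha> \<mu> = - n - 1\<close>. The sum over \<open>l\<close> has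
  finite support since \<open>exp_pos\<close> is locally nilpotent.
\<close>

definition vertex_mode ::
    "(int ^ 'n \<Rightarrow> int ^ 'n \<Rightarrow> int) \<Rightarrow> (int ^ 'n \<Rightarrow> int ^ 'n \<Rightarrow> bit) \<Rightarrow> int ^ 'n \<Rightarrow> int \<Rightarrow> 'n fock \<Rightarrow> 'n fock"
  where "vertex_mode B b \<alpha> n = lin_ext (\<lambda>(s, \<mu>). Sum_any (\<lambda>l::nat.
    let k = int l - B \<alpha> \<mu> - n - 1
    in if k < 0 then 0
       else exp_neg B \<alpha> (nat k) (exp_pos B \<alpha> l (exp_mult b \<alpha> (fock_basis (s, \<mu>))))))"

text \<open>
  \<open>Y\<close> is the (unique) super vertex algebra structure on \<open>V\<^sub>L\<close> with vacuum \<open>fock_vac\<close> and with the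
  prescribed fields for the generators \<open>u(-1) \<otimes> v\<^sub>0\<close> and \<open>v\<^sub>\<alpha>\<close>.
\<close>

definition lattice_vertex_structure ::
    "(int ^ 'n \<Rightarrow> int ^ 'n \<Rightarrow> int) \<Rightarrow> (int ^ 'n \<Rightarrow> int ^ 'n \<Rightarrow> bit) \<Rightarrow>
      ('n fock \<Rightarrow> int \<Rightarrow> 'n fock \<Rightarrow> 'n fock) \<Rightarrow> bool"
  where "lattice_vertex_structure B b Y \<longleftrightarrow>
    super_vertex_algebra fock_scale (fock_parity B) Y fock_vac \<and>
    (\<forall>u n v. Y (heis B u (-1) fock_vac) n v = heis B u n v) \<and>
    (\<forall>\<alpha> n v. Y (fock_exp \<alpha>) n v = vertex_mode B b \<alpha> n v)"

definition conformal_vector :: "(int ^ 'n \<Rightarrow> int ^ 'n \<Rightarrow> int) \<Rightarrow> 'n fock"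
  where "conformal_vector B = fock_scale (1/2) (\<Sum>i\<in>UNIV.
    heis B (\<chi> j. of_rat (dual_basis B i $ j)) (-1) (heis B (axis i 1) (-1) fock_vac))"

definition theta :: "'n::finite fock \<Rightarrow> 'n fock"
  where "theta = lin_ext (\<lambda>(s, \<alpha>). fock_scale ((-1) ^ size s) (fock_basis (s, - \<alpha>)))"


section \<open>The cone construction\<close>

definition cone_P :: "(rat ^ 'n) set"
  where "cone_P = {x. \<forall>i. 0 \<le> x $ i}"

definition cone_N :: "(rat ^ 'n) set"
  where "cone_N = {x. \<forall>i. x $ i < 0}"

definition cone_D :: "(rat ^ 'n) set"
  where "cone_D = cone_P \<union> cone_N"

definition lattice_points :: "(rat ^ 'n) set \<Rightarrow> (int ^ 'n) set"
  where "lattice_points S = {\<alpha>. lattice_vec \<alpha> \<in> S}"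

definition cone_space :: "(int ^ 'n \<Rightarrow> int ^ 'n \<Rightarrow> int) \<Rightarrow> bit \<Rightarrow> 'n fock set"
  where "cone_space B p = fock_supported (lattice_points cone_D) \<inter> fock_parity B p"

text \<open>The bilinear extension of the four defining cases; \<open>aP\<close>, \<open>aN\<close>, \<open>bP\<close>, \<open>bN\<close> are the components in
  \<open>V\<^sub>P\<^sub>(\<^sub>L\<^sub>)\<close> and \<open>V\<^sub>N\<^sub>(\<^sub>L\<^sub>)\<close>.\<close>

definition cone_Y ::
    "('n::finite fock \<Rightarrow> int \<Rightarrow> 'n fock \<Rightarrow> 'n fock) \<Rightarrow> 'n fock \<Rightarrow> int \<Rightarrow> 'n fock \<Rightarrow> 'n fock"
  where "cone_Y Y a n b =
    (let aP = fock_proj (lattice_points cone_P) a; aN = fock_proj (lattice_points cone_N) a;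
         bP = fock_proj (lattice_points cone_P) b; bN = fock_proj (lattice_points cone_N) b
     in Y aP n bP + Y (theta aP) n bN + Y aN n (theta bP) + theta (Y aN n bN))"

end

theory Submission
  imports Defs "HOL-Analysis.Cartesian_Space"
begin

text \<open>
  For \<open>s = \<plusminus>1\<close> let \<open>\<phi>\<^sub>s\<close> send \<open>a + a'\<close>, with \<open>a\<close> supported on \<open>P(L)\<close> and \<open>a'\<close> on \<open>N(L)\<close>, to
  \<open>a + s \<theta> a'\<close>. As \<open>\<theta>\<close> is an automorphism, the four cases in the definition of the product on the cone
  space say exactly that \<open>\<phi>\<^sub>s\<close> carries it to the product of \<open>V\<^sub>L\<close>. Both maps are even, fix the vacuum and
  \<open>\<omega>\<close>, and are jointly injective, so the identities of \<open>V\<^sub>L\<close> carry over.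

  For \<open>V\<^sub>L\<close> itself everything is reduced to the generators: \<open>\<theta>\<close> is compatible with their fields and hence, by
  the iterate formula, with all fields; \<open>[u(m), \<omega>\<^sub>(\<^sub>k\<^sub>)] = m u(m + k - 1)\<close> and the action of \<open>\<omega>\<close> on the \<open>v\<^sub>\<alpha>\<close> give the
  translation operator, the weights and the products \<open>\<omega>\<^sub>(\<^sub>i\<^sub>) \<omega>\<close>, hence the Virasoro relations. The modes \<open>u(0)\<close>
  are derivations, so by nondegeneracy the product respects the grading by the lattice.
\<close>


section \<open>Super vertex algebras\<close>

lemma Sum_any_eq_sum_lessThan:
  fixes f :: "nat \<Rightarrow> 'a::comm_monoid_add"
  assumes "\<And>i. N \<le> i \<Longrightarrow> f i = 0"
  shows "Sum_any f = (\<Sum>i<N. f i)"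
  using assms by (intro Sum_any.expand_superset) (auto simp: not_less[symmetric])

text \<open>Injectivity gives both families the same support, so the equation also covers infinite
  supports, where \<open>Sum_any\<close> takes the value 0.\<close>

lemma (in module_hom) Sum_any_inj:
  assumes "inj f"
  shows "f (Sum_any g) = Sum_any (\<lambda>i. f (g i))"
proof -
  have "f (g i) = 0 \<longleftrightarrow> g i = 0" for i
    using assms zero by (metis injD)
  then show ?thesis
    by (simp add: Sum_any.expand_set sum)
qed

context vector_space
begin

lemma subspace_super_space:
  assumes "\<And>p. subspace (V p)"
  shows "subspace (super_space V)"
  using subspace_sums[OF assms[of 0] assms[of 1]] by (simp add: super_space_def)

lemma super_space_base:
  assumes "\<And>p. subspace (V p)" and "a \<in> V q"
  shows "a \<in> super_space V"
proof (cases "q = 0")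
  case True
  then have "a = a + 0" "a \<in> V 0" "0 \<in> V 1"
    using assms subspace_0 by auto
  then show ?thesis
    unfolding super_space_def by blast
next
  case False
  then have "a = 0 + a" "a \<in> V 1" "0 \<in> V 0"
    using assms subspace_0 by (auto simp: bit_not_zero_iff)
  then show ?thesis
    unfolding super_space_def by blast
qed

end

context super_vertex_algebra
begin

lemmas base = super_space_base[of V, OF subspace_V]
  and subspace_space = subspace_super_space[of V, OF subspace_V]

lemma Y_0_left: "c \<in> super_space V \<Longrightarrow> Y 0 n c = 0"
  using scale_left[of 0 c 0 n] subspace_0[OF subspace_space] by simp

lemma Y_0_right: "a \<in> super_space V \<Longrightarrow> Y a n 0 = 0"
  using scale_right[of a 0 n 0] subspace_0[OF subspace_space] by simp

end

text \<open>The product \<open>Z\<close> on \<open>W\<close> embeds into a power of \<open>V\<close> through the jointly injective maps \<open>\<phi> s\<close>, so that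
  every identity that holds in \<open>V\<close> passes to \<open>W\<close>.\<close>

locale super_vertex_algebra_embedding = super_vertex_algebra scale V Y vac
  for scale :: "complex \<Rightarrow> 'v::ab_group_add \<Rightarrow> 'v" and V Y vac +
  fixes W :: "bit \<Rightarrow> 'v set" and Z :: "'v \<Rightarrow> int \<Rightarrow> 'v \<Rightarrow> 'v" and \<phi> :: "'s::finite \<Rightarrow> 'v \<Rightarrow> 'v"
  assumes subspace_W: "subspace (W p)"
    and parity_W: "\<lbrakk>a \<in> W p; b \<in> W q\<rbrakk> \<Longrightarrow> Z a n b \<in> W (p + q)"
    and closed_W: "\<lbrakk>a \<in> super_space W; b \<in> super_space W\<rbrakk> \<Longrightarrow> Z a n b \<in> super_space W"
    and linear_\<phi>: "Vector_Spaces.linear scale scale (\<phi> s)"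
    and parity_\<phi>: "a \<in> W p \<Longrightarrow> \<phi> s a \<in> V p"
    and mult_\<phi>: "\<lbrakk>a \<in> super_space W; b \<in> super_space W\<rbrakk> \<Longrightarrow> \<phi> s (Z a n b) = Y (\<phi> s a) n (\<phi> s b)"
    and inj_\<phi>: "\<lbrakk>a \<in> super_space W; \<And>s. \<phi> s a = 0\<rbrakk> \<Longrightarrow> a = 0"
    and vac_W: "vac \<in> W 0"
    and vac_\<phi>: "\<phi> s vac = vac"
begin

lemma hom_\<phi>: "module_hom scale scale (\<phi> s)"
  using linear_\<phi> by (simp add: module_hom_iff_linear)

lemmas \<phi>_add = module_hom.add[OF hom_\<phi>]
  and \<phi>_scale = module_hom.scale[OF hom_\<phi>]
  and \<phi>_diff = module_hom.diff[OF hom_\<phi>]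
  and \<phi>_sum = module_hom.sum[OF hom_\<phi>]
  and \<phi>_0 = module_hom.zero[OF hom_\<phi>]

lemmas base_W = super_space_base[of W, OF subspace_W]
  and space_W = subspace_super_space[of W, OF subspace_W]

lemmas W_mems = subspace_add[OF space_W] subspace_diff[OF space_W] subspace_scale[OF space_W]
  subspace_sum[OF space_W] subspace_0[OF space_W] closed_W

lemma eq_\<phi>:
  assumes "a \<in> super_space W" "b \<in> super_space W" "\<And>s. \<phi> s a = \<phi> s b"
  shows "a = b"
  using inj_\<phi>[of "a - b"] assms by (simp add: \<phi>_diff W_mems)

lemma \<phi>_space: "a \<in> super_space W \<Longrightarrow> \<phi> s a \<in> super_space V"
  unfolding super_space_def by (auto simp: \<phi>_add) (use parity_\<phi> in blast)

text \<open>There are finitely many maps \<open>\<phi> s\<close>, so the maximum of the truncation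
  bounds for the images serves them all, and joint injectivity brings the vanishing back to
  \<open>W\<close>.\<close>

lemma truncation_W:
  assumes "a \<in> super_space W" "b \<in> super_space W"
  shows "\<exists>N. \<forall>n\<ge>N. Z a n b = 0"
proof -
  have "\<exists>N. \<forall>n\<ge>N. Y (\<phi> s a) n (\<phi> s b) = 0" for s
    using truncation assms \<phi>_space by blast
  then obtain N where N: "\<And>s n. N s \<le> n \<Longrightarrow> Y (\<phi> s a) n (\<phi> s b) = 0"
    by metis
  have "Z a n b = 0" if "Max (range N) \<le> n" for n
  proof -
    have "N s \<le> n" for s
      using that Max_ge[of "range N" "N s"] by simp
    then have "\<phi> s (Z a n b) = 0" for s
      using assms by (simp add: mult_\<phi> N)
    then show ?thesis
      using inj_\<phi>[OF closed_W[OF assms]] by blast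
  qed
  then show ?thesis
    by blast
qed

text \<open>A single \<open>\<phi> s\<close> may have a kernel and then need not commute with
  \<open>Sum_any\<close>. Hence both sides are first cut to finite sums of one common length,
  compared under every \<open>\<phi> s\<close>, and identified by joint injectivity.\<close>

lemma borcherds_W:
  assumes a: "a \<in> W p" and b: "b \<in> W q" and c: "c \<in> super_space W"
  shows "Sum_any (\<lambda>i::nat. scale (of_int m gchoose i) (Z (Z a (n + int i) b) (m + k - int i) c)) =
      Sum_any (\<lambda>i::nat. scale ((-1) ^ i * (of_int n gchoose i))
        (Z a (m + n - int i) (Z b (k + int i) c)
          - scale ((-1) powi n * bit_sign (p * q)) (Z b (n + k - int i) (Z a (m + int i) c))))"
proof -
  note ab = base_W[OF a] base_W[OF b]
  have zl: "Z 0 n x = 0" and zr: "Z x n 0 = 0" if "x \<in> super_space W" for x n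
    by (rule inj_\<phi>; use that in \<open>simp add: mult_\<phi> W_mems \<phi>_0 Y_0_left Y_0_right \<phi>_space\<close>)+
  obtain N1 N2 N3 where N: "\<And>n. N1 \<le> n \<Longrightarrow> Z a n b = 0" "\<And>n. N2 \<le> n \<Longrightarrow> Z b n c = 0"
      "\<And>n. N3 \<le> n \<Longrightarrow> Z a n c = 0"
    using truncation_W ab c by metis
  \<comment> \<open>From \<open>K\<close> on, each of the three inner products in the identity
    vanishes, in \<open>W\<close> as well as after applying any \<open>\<phi> s\<close>.\<close>
  define K where "K = nat \<bar>N1 - n\<bar> + nat \<bar>N2 - k\<bar> + nat \<bar>N3 - m\<bar>"
  have K: "Z a (n + int i) b = 0" "Z b (k + int i) c = 0" "Z a (m + int i) c = 0" if "K \<le> i" for i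
    using that unfolding K_def by (auto intro!: N)
  have YK: "Y (\<phi> s a) (n + int i) (\<phi> s b) = 0" "Y (\<phi> s b) (k + int i) (\<phi> s c) = 0"
      "Y (\<phi> s a) (m + int i) (\<phi> s c) = 0" if "K \<le> i" for i s
    using K[OF that] by (metis mult_\<phi> ab c \<phi>_0)+
  let ?f = "\<lambda>i. scale (of_int m gchoose i) (Z (Z a (n + int i) b) (m + k - int i) c)"
  let ?g = "\<lambda>i. scale ((-1) ^ i * (of_int n gchoose i))
        (Z a (m + n - int i) (Z b (k + int i) c)
          - scale ((-1) powi n * bit_sign (p * q)) (Z b (n + k - int i) (Z a (m + int i) c)))"
  have "(\<Sum>i<K. ?f i) = (\<Sum>i<K. ?g i)"
  proof (rule eq_\<phi>)
    fix s
    let ?a = "\<phi> s a" and ?b = "\<phi> s b" and ?c = "\<phi> s c"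
    note V = \<phi>_space[OF ab(1), of s] \<phi>_space[OF ab(2), of s] \<phi>_space[OF c, of s]
    have "\<phi> s (\<Sum>i<K. ?f i) =
        Sum_any (\<lambda>i::nat. scale (of_int m gchoose i) (Y (Y ?a (n + int i) ?b) (m + k - int i) ?c))"
      using ab c V
      by (subst Sum_any_eq_sum_lessThan[of K]) (auto simp: \<phi>_sum \<phi>_scale mult_\<phi> W_mems YK Y_0_left)
    also have "\<dots> = Sum_any (\<lambda>i::nat. scale ((-1) ^ i * (of_int n gchoose i))
        (Y ?a (m + n - int i) (Y ?b (k + int i) ?c)
          - scale ((-1) powi n * bit_sign (p * q)) (Y ?b (n + k - int i) (Y ?a (m + int i) ?c))))"
      using borcherds[OF parity_\<phi>[OF a] parity_\<phi>[OF b] V(3)] by simp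
    also have "\<dots> = \<phi> s (\<Sum>i<K. ?g i)"
      using ab c V
      by (subst Sum_any_eq_sum_lessThan[of K])
        (auto simp: \<phi>_sum \<phi>_scale \<phi>_diff mult_\<phi> W_mems YK Y_0_right)
    finally show "\<phi> s (\<Sum>i<K. ?f i) = \<phi> s (\<Sum>i<K. ?g i)" .
  qed (use ab c in \<open>auto intro!: W_mems\<close>)
  moreover have "Sum_any ?f = (\<Sum>i<K. ?f i)" "Sum_any ?g = (\<Sum>i<K. ?g i)"
    using ab c by (auto intro!: Sum_any_eq_sum_lessThan simp: K zl zr)
  ultimately show ?thesis
    by simp
qed

lemma super_vertex_algebra_W: "super_vertex_algebra scale W Z vac"
proof unfold_locales
  show "W 0 \<inter> W 1 = {0}"
  proof -
    have "x = 0" if "x \<in> W 0" "x \<in> W 1" for x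
    proof (rule inj_\<phi>)
      show "\<phi> s x = 0" for s
        using direct parity_\<phi>[OF that(1)] parity_\<phi>[OF that(2)] by blast
    qed (rule base_W[OF that(1)])
    then show ?thesis
      using subspace_0[OF subspace_W] by auto
  qed
  note vac_sp = base_W[OF vac_W]
  show "Z (a + b) n c = Z a n c + Z b n c"
    if "a \<in> super_space W" "b \<in> super_space W" "c \<in> super_space W" for a b c n
    by (rule eq_\<phi>; use that in \<open>simp add: W_mems mult_\<phi> \<phi>_add add_left \<phi>_space\<close>)
  show "Z a n (b + c) = Z a n b + Z a n c"
    if "a \<in> super_space W" "b \<in> super_space W" "c \<in> super_space W" for a b c n
    by (rule eq_\<phi>; use that in \<open>simp add: W_mems mult_\<phi> \<phi>_add add_right \<phi>_space\<close>)
  show "Z (scale r a) n b = scale r (Z a n b)" if "a \<in> super_space W" "b \<in> super_space W" for a b n r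
    by (rule eq_\<phi>; use that in \<open>simp add: W_mems mult_\<phi> \<phi>_scale scale_left \<phi>_space\<close>)
  show "Z a n (scale r b) = scale r (Z a n b)" if "a \<in> super_space W" "b \<in> super_space W" for a b n r
    by (rule eq_\<phi>; use that in \<open>simp add: W_mems mult_\<phi> \<phi>_scale scale_right \<phi>_space\<close>)
  show "Z vac n a = (if n = -1 then a else 0)" if "a \<in> super_space W" for a n
    by (rule eq_\<phi>; use that vac_sp in \<open>simp add: W_mems mult_\<phi> vac_\<phi> vac_left \<phi>_space \<phi>_0\<close>)
  show "Z a (-1) vac = a" if "a \<in> super_space W" for a
    by (rule eq_\<phi>; use that vac_sp in \<open>simp add: W_mems mult_\<phi> vac_\<phi> creation \<phi>_space\<close>)
  show "Z a n vac = 0" if "a \<in> super_space W" "0 \<le> n" for a n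
    by (rule inj_\<phi>; use that vac_sp in \<open>simp add: W_mems mult_\<phi> vac_\<phi> creation_nonneg \<phi>_space\<close>)
qed (use subspace_W parity_W truncation_W vac_W borcherds_W in \<open>auto\<close>)

text \<open>Identities pull back along the \<open>\<phi> s\<close>. Diagonalizability asks for
  enough eigenvectors, which have to be found in \<open>W\<close> itself, and is therefore an
  assumption.\<close>

lemma conformal_super_vertex_algebra_W:
  assumes \<omega>: "\<omega> \<in> W 0" and \<phi>\<omega>: "\<And>s. \<phi> s \<omega> = \<omega>"
    and vir: "\<And>m n v. v \<in> super_space V \<Longrightarrow>
      vir_mode Y \<omega> m (vir_mode Y \<omega> n v) - vir_mode Y \<omega> n (vir_mode Y \<omega> m v) =
        scale (of_int (m - n)) (vir_mode Y \<omega> (m + n) v)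
        + (if m + n = 0 then scale (of_int (m ^ 3 - m) / 12 * r) v else 0)"
    and trans: "\<And>a. a \<in> super_space V \<Longrightarrow> Y \<omega> 0 a = Y a (-2) vac"
    and diag: "super_space W \<subseteq> span {v \<in> super_space W. \<exists>h. vir_mode Z \<omega> 0 v = scale h v}"
  shows "conformal_super_vertex_algebra scale W Z vac \<omega>"
proof -
  interpret W: super_vertex_algebra scale W Z vac
    by (rule super_vertex_algebra_W)
  note sp = base_W[OF \<omega>] base_W[OF vac_W]
  have mode_W: "vir_mode Z \<omega> n v \<in> super_space W" if "v \<in> super_space W" for n v
    unfolding vir_mode_def by (rule closed_W[OF sp(1) that])
  have mode_\<phi>: "\<phi> s (vir_mode Z \<omega> n v) = vir_mode Y \<omega> n (\<phi> s v)" if "v \<in> super_space W" for n v s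
    unfolding vir_mode_def by (simp add: mult_\<phi>[OF sp(1) that] \<phi>\<omega>)
  show ?thesis
  proof unfold_locales
    show "\<exists>c. \<forall>m n. \<forall>v\<in>super_space W.
      vir_mode Z \<omega> m (vir_mode Z \<omega> n v) - vir_mode Z \<omega> n (vir_mode Z \<omega> m v) =
        scale (of_int (m - n)) (vir_mode Z \<omega> (m + n) v)
        + (if m + n = 0 then scale (of_int (m ^ 3 - m) / 12 * c) v else 0)"
    proof (intro exI[of _ r] allI ballI)
      fix m n v
      assume v: "v \<in> super_space W"
      show "vir_mode Z \<omega> m (vir_mode Z \<omega> n v) - vir_mode Z \<omega> n (vir_mode Z \<omega> m v) =
        scale (of_int (m - n)) (vir_mode Z \<omega> (m + n) v)
        + (if m + n = 0 then scale (of_int (m ^ 3 - m) / 12 * r) v else 0)"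
      proof (rule eq_\<phi>)
        fix s
        show "\<phi> s (vir_mode Z \<omega> m (vir_mode Z \<omega> n v) - vir_mode Z \<omega> n (vir_mode Z \<omega> m v)) =
          \<phi> s (scale (of_int (m - n)) (vir_mode Z \<omega> (m + n) v)
            + (if m + n = 0 then scale (of_int (m ^ 3 - m) / 12 * r) v else 0))"
          using vir[OF \<phi>_space[OF v, of s], of m n]
          by (simp add: \<phi>_add \<phi>_diff \<phi>_scale \<phi>_0 mode_\<phi> mode_W v if_distrib[of "\<phi> s"] del: of_int_diff)
      qed (use v in \<open>simp_all add: W_mems mode_W\<close>)
    qed
    show "vir_mode Z \<omega> (-1) a = Z a (-2) vac" if "a \<in> super_space W" for a
      by (rule eq_\<phi>; use that sp in \<open>simp add: vir_mode_def mult_\<phi> \<phi>\<omega> vac_\<phi> closed_W trans \<phi>_space\<close>)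
  qed (use \<omega> diag in auto)
qed

end

section \<open>Consequences of the Borcherds identity for an even left factor\<close>

locale full_super_vertex_algebra = super_vertex_algebra +
  assumes full: "super_space V = UNIV"
begin

lemma hom_left: "module_hom scale scale (\<lambda>a. Y a n c)"
  and hom_right: "module_hom scale scale (Y a n)"
  by (unfold_locales; simp add: full add_left add_right scale_left scale_right)+

lemmas Y_left = module_hom.add[OF hom_left] module_hom.scale[OF hom_left] module_hom.zero[OF hom_left]
    module_hom.diff[OF hom_left] module_hom.sum[OF hom_left] module_hom.neg[OF hom_left]
  and Y_right = module_hom.add[OF hom_right] module_hom.scale[OF hom_right] module_hom.zero[OF hom_right]
    module_hom.diff[OF hom_right] module_hom.sum[OF hom_right] module_hom.neg[OF hom_right]

lemma Y_vac: "Y vac n c = (if n = -1 then c else 0)"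
  by (simp add: vac_left full)

text \<open>The case \<open>n = 0\<close> of the Borcherds identity: the binomial coefficients on
  its right-hand side vanish except at \<open>i = 0\<close>, and no sign occurs since
  \<open>a\<close> is even.\<close>

lemma commutator:
  assumes a: "a \<in> V 0" and b: "b \<in> V q" and N: "\<And>i. N \<le> i \<Longrightarrow> Y a (int i) b = 0"
  shows "Y a m (Y b k c) - Y b k (Y a m c) =
    (\<Sum>i<N. scale (of_int m gchoose i) (Y (Y a (int i) b) (m + k - int i) c))"
proof -
  have "(\<Sum>i<N. scale (of_int m gchoose i) (Y (Y a (int i) b) (m + k - int i) c)) =
      Sum_any (\<lambda>i::nat. scale (of_int m gchoose i) (Y (Y a (0 + int i) b) (m + k - int i) c))"
    by (subst Sum_any_eq_sum_lessThan[of N]) (auto simp: N Y_left)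
  also have "\<dots> = Y a m (Y b k c) - Y b k (Y a m c)"
    by (subst borcherds[OF a b], simp add: full, subst Sum_any_eq_sum_lessThan[of 1])
      (auto simp: bit_sign_def gbinomial_0_left)
  finally show ?thesis
    by simp
qed

text \<open>The commutator formula at \<open>m = 0\<close>, where only the term \<open>i = 0\<close>
  is left.\<close>

lemma derivation:
  assumes a: "a \<in> V 0" and b: "b \<in> V q"
  shows "Y a 0 (Y b k c) = Y (Y a 0 b) k c + Y b k (Y a 0 c)"
proof -
  obtain N where N: "\<And>n. N \<le> n \<Longrightarrow> Y a n b = 0"
    using truncation[of a b] full by auto
  have "Y a 0 (Y b k c) - Y b k (Y a 0 c) =
      (\<Sum>i<Suc (nat N). scale (of_int 0 gchoose i) (Y (Y a (int i) b) (0 + k - int i) c))"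
    by (rule commutator[OF a b]) (simp add: N)
  also have "\<dots> = (\<Sum>i<Suc (nat N). if i = 0 then Y (Y a 0 b) k c else 0)"
    by (intro sum.cong) (auto simp: gbinomial_0_left)
  finally show ?thesis
    by (simp add: algebra_simps)
qed

text \<open>The case \<open>m = 0\<close> of the Borcherds identity, whose left-hand side is then a
  single term. It computes the field of a product from the fields of its factors.\<close>

lemma iterate:
  assumes a: "a \<in> V 0" and b: "b \<in> V q"
  shows "Y (Y a n b) k c = Sum_any (\<lambda>i::nat. scale ((-1) ^ i * (of_int n gchoose i))
        (Y a (n - int i) (Y b (k + int i) c)
          - scale ((-1) powi n) (Y b (n + k - int i) (Y a (int i) c))))"
proof -
  have "Y (Y a n b) k c =
      Sum_any (\<lambda>i::nat. scale (of_int 0 gchoose i) (Y (Y a (n + int i) b) (0 + k - int i) c))"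
    by (subst Sum_any_eq_sum_lessThan[of 1]) (auto simp: gbinomial_0_left)
  also have "\<dots> = Sum_any (\<lambda>i::nat. scale ((-1) ^ i * (of_int n gchoose i))
        (Y a (n - int i) (Y b (k + int i) c)
          - scale ((-1) powi n) (Y b (n + k - int i) (Y a (int i) c))))"
    by (subst borcherds[OF a b]) (simp_all add: full bit_sign_def)
  finally show ?thesis .
qed

lemma gbinomial_minus_2: "(-1) ^ i * ((-2::complex) gchoose i) = of_nat (Suc i)"
proof -
  have "(-2::complex) gchoose i = (-1) ^ i * of_nat (Suc i)"
    using gbinomial_minus[of "2::complex" i] binomial_gbinomial[of "Suc i" i, where 'a=complex]
    by (simp add: add.commute)
  then show ?thesis
    by (simp add: power_mult_distrib[symmetric] mult.assoc[symmetric])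
qed

text \<open>The field of the derivative of \<open>a\<close> is the derivative of its field. This is
  the iterate formula with the vacuum as second factor, whose mode of index -1 is the identity and
  whose other modes are 0.\<close>

lemma translation_left:
  assumes a: "a \<in> V 0"
  shows "Y (Y a (-2) vac) k c = scale (of_int (- k)) (Y a (k - 1) c)"
proof -
  have pw: "(-1::complex) powi (-2) = 1"
    by (simp add: power_int_minus)
  have "Y (Y a (-2) vac) k c = Sum_any (\<lambda>i::nat. scale (of_nat (Suc i))
        ((if int i = - k - 1 then Y a (k - 1) c else 0)
          - (if int i = k - 1 then Y a (k - 1) c else 0)))"
    by (subst iterate[OF a vac_even], intro Sum_any.cong)
      (auto simp: gbinomial_minus_2 pw Y_vac Y_right simp del: of_nat_Suc)
  also have "\<dots> = (\<Sum>i<Suc (nat \<bar>k\<bar>). scale (of_nat (Suc i))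
        ((if int i = - k - 1 then Y a (k - 1) c else 0)
          - (if int i = k - 1 then Y a (k - 1) c else 0)))"
    by (intro Sum_any_eq_sum_lessThan) auto
  \<comment> \<open>The first alternative can occur only for \<open>k < 0\<close> and the second
    only for \<open>k > 0\<close>, in both cases at \<open>i = \<bar>k\<bar> - 1\<close> with
    coefficient \<open>i + 1 = \<bar>k\<bar>\<close>, and the signs combine to \<open>- k\<close>.
    For \<open>k = 0\<close> neither occurs and the coefficient is 0.\<close>
  also have "\<dots> = (\<Sum>i<Suc (nat \<bar>k\<bar>). if i = nat (\<bar>k\<bar> - 1) then scale (of_int (- k)) (Y a (k - 1) c) else 0)"
    by (intro sum.cong) (auto simp: algebra_simps scale_left_distrib split: if_splits)
  also have "\<dots> = scale (of_int (- k)) (Y a (k - 1) c)"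
    by (auto simp: sum.delta)
  finally show ?thesis .
qed

text \<open>The iterate formula applied to the vacuum, which nonnegative modes annihilate: only the
  terms \<open>i = 0\<close> and \<open>i = 1\<close> remain, the latter containing
  \<open>Y b (-1) vac = b\<close>.\<close>

lemma translation_product:
  assumes a: "a \<in> V 0" and b: "b \<in> V q"
  shows "Y (Y a n b) (-2) vac = Y a n (Y b (-2) vac) - scale (of_int n) (Y a (n - 1) b)"
proof -
  have [simp]: "Y a (int i) vac = 0" for i
    by (simp add: creation_nonneg full)
  have [simp]: "Y b (int i - 2) vac = 0" if "2 \<le> i" for i
    using that by (simp add: creation_nonneg full)
  have "Y (Y a n b) (-2) vac = (\<Sum>i<2::nat. scale ((-1) ^ i * (of_int n gchoose i))
        (Y a (n - int i) (Y b (-2 + int i) vac)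
          - scale ((-1) powi n) (Y b (n + (-2) - int i) (Y a (int i) vac))))"
    by (subst iterate[OF a b], intro Sum_any_eq_sum_lessThan) (simp add: Y_right)
  also have "\<dots> = Y a n (Y b (-2) vac) - scale (of_int n) (Y a (n - 1) b)"
    by (simp add: numeral_2_eq_2 Y_right creation full)
  finally show ?thesis .
qed

text \<open>The commutator formula needs only the products of \<open>\<omega>\<close> with itself at
  indices 0 to 3. Index 0 contributes \<open>- (m + n + 2)\<close> and index 1 contributes
  \<open>2 * (m + 1)\<close>, together \<open>m - n\<close>. Index 3 contributes the central term
  through the binomial coefficient \<open>(m ^ 3 - m) / 6\<close>, so \<open>r\<close> is the
  central charge.\<close>

lemma virasoro_relations:
  assumes \<omega>: "\<omega> \<in> V 0"
    and "Y \<omega> 0 \<omega> = Y \<omega> (-2) vac" "Y \<omega> 1 \<omega> = scale 2 \<omega>" "Y \<omega> 2 \<omega> = 0" "Y \<omega> 3 \<omega> = scale (r / 2) vac"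
    and ge4: "\<And>n. 4 \<le> n \<Longrightarrow> Y \<omega> n \<omega> = 0"
  shows "vir_mode Y \<omega> m (vir_mode Y \<omega> n v) - vir_mode Y \<omega> n (vir_mode Y \<omega> m v) =
        scale (of_int (m - n)) (vir_mode Y \<omega> (m + n) v)
        + (if m + n = 0 then scale (of_int (m ^ 3 - m) / 12 * r) v else 0)"
proof -
  have g3: "of_int (m + 1) gchoose 3 = (of_int (m ^ 3 - m) / 6 :: complex)"
    by (simp add: gbinomial_prod_rev numeral_3_eq_3 fact_numeral prod.atLeast0_lessThan_Suc)
      (simp add: field_simps power3_eq_cube)
  have "Y \<omega> (m + 1) (Y \<omega> (n + 1) v) - Y \<omega> (n + 1) (Y \<omega> (m + 1) v) =
    (\<Sum>i<4. scale (of_int (m + 1) gchoose i) (Y (Y \<omega> (int i) \<omega>) (m + 1 + (n + 1) - int i) v))"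
    by (rule commutator[OF \<omega> \<omega>]) (simp add: ge4)
  also have "\<dots> = Y (Y \<omega> (-2) vac) (m + n + 2) v + scale (of_int (m + 1)) (Y (scale 2 \<omega>) (m + n + 1) v)
      + scale (of_int (m + 1) gchoose 3) (Y (scale (r / 2) vac) (m + n - 1) v)"
    using assms(2-5) by (simp add: lessThan_nat_numeral lessThan_Suc Y_left numeral_3_eq_3 algebra_simps)
  also have "\<dots> = scale (of_int (m - n)) (Y \<omega> (m + n + 1) v)
        + (if m + n = 0 then scale (of_int (m ^ 3 - m) / 12 * r) v else 0)"
  proof -
    have *: "m + n - 1 = -1 \<longleftrightarrow> m + n = 0" "m + n + 2 - 1 = m + n + 1"
      by auto
    have "scale (of_int (- (m + n + 2))) x + scale (of_int (m + 1)) (scale 2 x) = scale (of_int (m - n)) x" for x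
      by (simp only: scale_scale scale_left_distrib[symmetric]) (simp add: algebra_simps)
    then show ?thesis
      by (simp only: translation_left[OF \<omega>] Y_left Y_vac g3 * ) (simp add: field_simps)
  qed
  finally show ?thesis
    by (simp add: vir_mode_def)
qed

end


section \<open>The Fock space\<close>

lemma lookup_fock_scale: "Poly_Mapping.lookup (fock_scale c v) x = c * Poly_Mapping.lookup v x"
  unfolding fock_scale_def by (simp add: map.rep_eq when_def)

interpretation fock: vector_space fock_scale
  by unfold_locales (auto intro!: poly_mapping_eqI simp: lookup_fock_scale lookup_add algebra_simps)

interpretation fock_pair: module_pair fock_scale fock_scale ..

abbreviation fock_hom :: "('n::finite fock \<Rightarrow> 'n fock) \<Rightarrow> bool"
  where "fock_hom \<equiv> module_hom fock_scale fock_scale"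

lemma fock_homI:
  assumes "\<And>v w. f (v + w) = f v + f w" "\<And>c v. f (fock_scale c v) = fock_scale c (f v)"
  shows "fock_hom f"
  by (simp add: module_hom_iff fock.module_axioms assms)

lemma fock_expand:
  "(v :: 'n::finite fock) = (\<Sum>x\<in>Poly_Mapping.keys v. fock_scale (Poly_Mapping.lookup v x) (fock_basis x))"
proof (rule poly_mapping_eqI)
  fix y
  have "Poly_Mapping.lookup (\<Sum>x\<in>Poly_Mapping.keys v. fock_scale (Poly_Mapping.lookup v x) (fock_basis x)) y =
     (\<Sum>x\<in>Poly_Mapping.keys v. if x = y then Poly_Mapping.lookup v y else 0)"
    unfolding lookup_sum lookup_fock_scale fock_basis_def
    by (intro sum.cong) (auto simp: lookup_single when_def)
  then show "Poly_Mapping.lookup v y =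
      Poly_Mapping.lookup (\<Sum>x\<in>Poly_Mapping.keys v. fock_scale (Poly_Mapping.lookup v x) (fock_basis x)) y"
    by (simp add: in_keys_iff)
qed

lemma fock_hom_eqI:
  fixes v :: "'n::finite fock"
  assumes "fock_hom f" "fock_hom g" "\<And>x. x \<in> Poly_Mapping.keys v \<Longrightarrow> f (fock_basis x) = g (fock_basis x)"
  shows "f v = g v"
  using assms by (subst (1 2) fock_expand) (simp add: module_hom.sum module_hom.scale)

lemma fock_hom_mem:
  fixes v :: "'n::finite fock"
  assumes "fock_hom f" "fock.subspace S" "\<And>x. x \<in> Poly_Mapping.keys v \<Longrightarrow> f (fock_basis x) \<in> S"
  shows "f v \<in> S"
  using assms
  by (subst fock_expand) (auto simp: module_hom.sum module_hom.scale intro!: fock.subspace_sum fock.subspace_scale)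

lemma lin_ext_superset:
  fixes v :: "'n::finite fock"
  assumes "finite A" "Poly_Mapping.keys v \<subseteq> A"
  shows "lin_ext f v = (\<Sum>x\<in>A. fock_scale (Poly_Mapping.lookup v x) (f x))"
  unfolding lin_ext_def using assms by (intro sum.mono_neutral_left) (auto simp: in_keys_iff)

lemma hom_lin_ext: "fock_hom (lin_ext f)"
proof (rule fock_homI)
  fix v w :: "'a fock" and c
  let ?A = "Poly_Mapping.keys v \<union> Poly_Mapping.keys w"
  show "lin_ext f (v + w) = lin_ext f v + lin_ext f w"
    using Poly_Mapping.keys_add[of v w]
    by (simp add: lin_ext_superset[of ?A] lookup_add fock.scale_left_distrib sum.distrib)
  have "Poly_Mapping.keys (fock_scale c v) \<subseteq> Poly_Mapping.keys v"
    by (auto simp: in_keys_iff lookup_fock_scale)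
  then show "lin_ext f (fock_scale c v) = fock_scale c (lin_ext f v)"
    by (simp add: lin_ext_superset[of "Poly_Mapping.keys v"] lookup_fock_scale fock.scale_sum_right)
qed

lemma lin_ext_basis [simp]: "lin_ext f (fock_basis x) = f x"
  by (simp add: lin_ext_def fock_basis_def)

lemma fock_half: "fock_scale (1/2) (v + v) = v"
  by (simp only: fock.scale_right_distrib fock.scale_left_distrib[symmetric]) simp

text \<open>For reading off eigenvalues: an eigenvector of a diagonal operator only involves basis
  elements with its eigenvalue. This is applied to the modes \<open>u(0)\<close> and to the weight
  operator.\<close>

lemma lookup_diagonal:
  assumes "fock_hom f" "\<And>x. f (fock_basis x) = fock_scale (c x) (fock_basis x)"
  shows "Poly_Mapping.lookup (f v) y = c y * Poly_Mapping.lookup v y"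
proof -
  have "f v = (\<Sum>x\<in>Poly_Mapping.keys v. fock_scale (Poly_Mapping.lookup v x * c x) (fock_basis x))"
    by (subst fock_expand[of v]) (simp add: module_hom.sum[OF assms(1)] module_hom.scale[OF assms(1)] assms(2))
  then have "Poly_Mapping.lookup (f v) y = (\<Sum>x\<in>Poly_Mapping.keys v. if x = y then c y * Poly_Mapping.lookup v y else 0)"
    by (simp only: lookup_sum lookup_fock_scale fock_basis_def)
      (intro sum.cong, auto simp: lookup_single when_def)
  then show ?thesis
    by (simp add: in_keys_iff)
qed

section \<open>Lattice support and projections\<close>

lemma subspace_fock_supported: "fock.subspace (fock_supported K)"
proof (rule fock.subspaceI)
  show "v + w \<in> fock_supported K" if "v \<in> fock_supported K" "w \<in> fock_supported K" for v w
    using that Poly_Mapping.keys_add[of v w] unfolding fock_supported_def by blast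
qed (auto simp: fock_supported_def in_keys_iff lookup_fock_scale)

lemma fock_basis_supported: "fock_basis (s, \<alpha>) \<in> fock_supported K \<longleftrightarrow> \<alpha> \<in> K"
  by (simp add: fock_supported_def fock_basis_def)

lemma fock_supported_keys: "v \<in> fock_supported K \<Longrightarrow> (s, \<alpha>) \<in> Poly_Mapping.keys v \<Longrightarrow> \<alpha> \<in> K"
  unfolding fock_supported_def by blast

lemma fock_supported_mono: "v \<in> fock_supported K \<Longrightarrow> K \<subseteq> K' \<Longrightarrow> v \<in> fock_supported K'"
  unfolding fock_supported_def by blast

lemma fock_supported_Int: "fock_supported K \<inter> fock_supported K' = fock_supported (K \<inter> K')"
  unfolding fock_supported_def by blast

lemma fock_supported_hom:
  assumes "v \<in> fock_supported K" "fock_hom f" "fock.subspace S" "\<And>s \<alpha>. \<alpha> \<in> K \<Longrightarrow> f (fock_basis (s, \<alpha>)) \<in> S"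
  shows "f v \<in> S"
  by (rule fock_hom_mem[OF assms(2,3)]) (use assms(1,4) in \<open>auto dest: fock_supported_keys\<close>)

lemma fock_hom_ident: "fock_hom (\<lambda>v :: 'n::finite fock. v)"
  by (rule fock_homI) simp_all

lemma hom_fock_proj: "fock_hom (fock_proj K)"
  unfolding fock_proj_def by (rule hom_lin_ext)

lemma fock_proj_basis: "fock_proj K (fock_basis (s, \<alpha>)) = (if \<alpha> \<in> K then fock_basis (s, \<alpha>) else 0)"
  unfolding fock_proj_def by simp

lemma fock_proj_supported: "fock_proj K v \<in> fock_supported K"
  by (rule fock_hom_mem[OF hom_fock_proj subspace_fock_supported])
    (auto simp: fock_proj_basis fock_basis_supported fock.subspace_0[OF subspace_fock_supported])

lemma fock_proj_supported_other: "v \<in> fock_supported K' \<Longrightarrow> fock_proj K v \<in> fock_supported K'"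
  by (erule fock_supported_hom[OF _ hom_fock_proj subspace_fock_supported])
    (auto simp: fock_proj_basis fock_basis_supported fock.subspace_0[OF subspace_fock_supported])

lemma fock_proj_id: "v \<in> fock_supported K \<Longrightarrow> fock_proj K v = v"
  by (rule fock_hom_eqI[OF hom_fock_proj fock_hom_ident]) (auto simp: fock_proj_basis dest: fock_supported_keys)

lemma fock_proj_disjoint:
  assumes "v \<in> fock_supported K'" "K \<inter> K' = {}"
  shows "fock_proj K v = 0"
proof -
  have "\<alpha> \<notin> K" if "(s, \<alpha>) \<in> Poly_Mapping.keys v" for s \<alpha>
    using that assms fock_supported_keys by blast
  then show ?thesis
    by - (rule fock_hom_eqI[OF hom_fock_proj fock_pair.module_hom_zero], auto simp: fock_proj_basis)
qed

lemma fock_proj_Un: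
  assumes "v \<in> fock_supported (K \<union> K')" "K \<inter> K' = {}"
  shows "fock_proj K v + fock_proj K' v = v"
  by (rule fock_hom_eqI[OF fock_pair.module_hom_add[OF hom_fock_proj hom_fock_proj] fock_hom_ident])
    (use assms in \<open>auto simp: fock_proj_basis dest: fock_supported_keys\<close>)

section \<open>The involution on the Fock space\<close>

lemma hom_theta: "fock_hom theta"
  unfolding theta_def by (rule hom_lin_ext)

lemma theta_basis: "theta (fock_basis (s, \<alpha>)) = fock_scale ((-1) ^ size s) (fock_basis (s, - \<alpha>))"
  unfolding theta_def by simp

lemmas theta_add = module_hom.add[OF hom_theta]
  and theta_scale = module_hom.scale[OF hom_theta]
  and theta_neg = module_hom.neg[OF hom_theta]
  and theta_diff = module_hom.diff[OF hom_theta]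
  and theta_sum = module_hom.sum[OF hom_theta]
  and theta_0 [simp] = module_hom.zero[OF hom_theta]

lemma theta_theta [simp]: "theta (theta v) = v"
proof -
  have "(theta \<circ> theta) v = v"
    by (rule fock_hom_eqI[OF module_hom_compose[OF hom_theta hom_theta] fock_hom_ident])
      (auto simp: theta_basis theta_scale power_mult_distrib[symmetric])
  then show ?thesis
    by simp
qed

lemma inj_theta: "inj theta"
  by (metis injI theta_theta)

lemmas theta_Sum_any = module_hom.Sum_any_inj[OF hom_theta inj_theta]

lemma theta_supported: "v \<in> fock_supported K \<Longrightarrow> theta v \<in> fock_supported (uminus ` K)"
  by (erule fock_supported_hom[OF _ hom_theta subspace_fock_supported])
    (auto simp: theta_basis fock_basis_supported intro!: fock.subspace_scale[OF subspace_fock_supported])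

lemma theta_vac: "theta fock_vac = fock_vac"
  by (simp add: fock_vac_def fock_exp_def theta_basis)


section \<open>The Heisenberg operators\<close>

lemma hom_heis: "fock_hom (heis B u m)"
  unfolding heis_def by (rule hom_lin_ext)

lemmas heis_add = module_hom.add[OF hom_heis]
  and heis_scale = module_hom.scale[OF hom_heis]
  and heis_sum = module_hom.sum[OF hom_heis]
  and heis_0 [simp] = module_hom.zero[OF hom_heis]

lemma heis_neg_basis: "m < 0 \<Longrightarrow> heis B u m (fock_basis (s, \<mu>)) =
    (\<Sum>i\<in>UNIV. fock_scale (u $ i) (fock_basis (add_mset (i, nat (- m - 1)) s, \<mu>)))"
  by (simp add: heis_def)

lemma heis_zero_basis: "heis B u 0 (fock_basis (s, \<mu>)) =
    fock_scale (form_ext B u (lattice_vec \<mu>)) (fock_basis (s, \<mu>))"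
  by (simp add: heis_def)

lemma heis_pos_basis: "m > 0 \<Longrightarrow> heis B u m (fock_basis (s, \<mu>)) =
    (\<Sum>i\<in>UNIV. fock_scale (of_nat (count s (i, nat (m - 1))) * (of_int m * form_ext B u (axis i 1)))
        (fock_basis (s - {#(i, nat (m - 1))#}, \<mu>)))"
  by (simp add: heis_def)

lemma form_ext_add_left: "form_ext B (u + v) w = form_ext B u w + form_ext B v w"
  and form_ext_add_right: "form_ext B w (u + v) = form_ext B w u + form_ext B w v"
  and form_ext_scale_left: "form_ext B (c *s u) w = c * form_ext B u w"
  and form_ext_scale_right: "form_ext B w (c *s u) = c * form_ext B w u"
  and form_ext_diff_left: "form_ext B (u - v) w = form_ext B u w - form_ext B v w"
  and form_ext_minus_right: "form_ext B w (- u) = - form_ext B w u"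
  and form_ext_0_left: "form_ext B 0 w = 0"
  and form_ext_0_right: "form_ext B w 0 = 0"
  by (simp_all add: form_ext_def algebra_simps sum.distrib sum_distrib_left sum_subtractf sum_negf)

lemma form_ext_sum_left: "form_ext B (\<Sum>x\<in>A. f x) w = (\<Sum>x\<in>A. form_ext B (f x) w)"
  by (induction A rule: infinite_finite_induct) (simp_all add: form_ext_add_left form_ext_0_left)

lemma form_ext_sum_right: "form_ext B w (\<Sum>x\<in>A. f x) = (\<Sum>x\<in>A. form_ext B w (f x))"
  by (induction A rule: infinite_finite_induct) (simp_all add: form_ext_add_right form_ext_0_right)

lemma heis_add_vec: "heis B (u + w) m v = heis B u m v + heis B w m v"
proof (rule fock_hom_eqI[OF hom_heis fock_pair.module_hom_add[OF hom_heis hom_heis]])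
  fix x :: "'a fock_index"
  obtain s \<mu> where x: "x = (s, \<mu>)"
    by (cases x)
  consider "m < 0" | "m = 0" | "m > 0"
    by linarith
  then show "heis B (u + w) m (fock_basis x) = heis B u m (fock_basis x) + heis B w m (fock_basis x)"
    by cases (simp_all add: x heis_neg_basis heis_zero_basis heis_pos_basis sum.distrib
        fock.scale_left_distrib form_ext_add_left distrib_left)
qed

lemma heis_scale_vec: "heis B (c *s u) m v = fock_scale c (heis B u m v)"
proof (rule fock_hom_eqI[OF hom_heis fock_pair.module_hom_scale[OF hom_heis]])
  fix x :: "'a fock_index"
  obtain s \<mu> where x: "x = (s, \<mu>)"
    by (cases x)
  consider "m < 0" | "m = 0" | "m > 0"
    by linarith
  then show "heis B (c *s u) m (fock_basis x) = fock_scale c (heis B u m (fock_basis x))"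
    by cases (simp_all add: x heis_neg_basis heis_zero_basis heis_pos_basis fock.scale_sum_right
        form_ext_scale_left algebra_simps)
qed

lemma heis_sum_vec: "heis B (\<Sum>x\<in>A. c x *s f x) m v = (\<Sum>x\<in>A. fock_scale (c x) (heis B (f x) m v))"
proof (induction A rule: infinite_finite_induct)
  case empty
  then show ?case
    using heis_scale_vec[of B 0 0 m v] by simp
qed (simp_all add: heis_add_vec heis_scale_vec heis_scale_vec[of B 0 0, simplified])

text \<open>Turns an induction over the multiset into successive application of creation operators
  to \<open>fock_exp \<mu>\<close>. The index is \<open>- 1 - int k\<close> because the modes are
  counted from 0.\<close>

lemma fock_basis_add_mset:
  "fock_basis (add_mset (i, k) s, \<mu>) = heis B (axis i 1) (- 1 - int k) (fock_basis (s, \<mu>))"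
proof -
  have "heis B (axis i 1) (- 1 - int k) (fock_basis (s, \<mu>)) =
      (\<Sum>j\<in>UNIV. if j = i then fock_basis (add_mset (i, k) s, \<mu>) else 0)"
    by (simp only: heis_neg_basis) (intro sum.cong, auto simp: axis_def)
  then show ?thesis
    by simp
qed

lemma heis_pos_exp: "m > 0 \<Longrightarrow> heis B u m (fock_exp \<mu>) = 0"
  by (simp add: fock_exp_def heis_pos_basis)

lemma heis_zero_exp: "heis B u 0 (fock_exp \<mu>) = fock_scale (form_ext B u (lattice_vec \<mu>)) (fock_exp \<mu>)"
  by (simp add: fock_exp_def heis_zero_basis)

lemma lattice_vec_0 [simp]: "lattice_vec 0 = 0"
  and lattice_vec_uminus: "lattice_vec (- \<alpha>) = (- lattice_vec \<alpha> :: 'a::ring_1 ^ 'n)"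
  and lattice_vec_add: "lattice_vec (\<alpha> + \<beta>) = (lattice_vec \<alpha> + lattice_vec \<beta> :: 'a::ring_1 ^ 'n)"
  by (simp_all add: lattice_vec_def vec_eq_iff)

text \<open>These products of two generators are all that the commutator formula needs to give the
  Heisenberg relations.\<close>

lemma heis_nonneg_one:
  assumes "0 \<le> i"
  shows "heis B u i (heis B v (-1) fock_vac) = (if i = 1 then fock_scale (form_ext B u v) fock_vac else 0)"
proof -
  have 1: "heis B u i (fock_basis ({#(j, 0)#}, 0)) =
      (if i = 1 then fock_scale (form_ext B u (axis j 1)) fock_vac else 0)" for j
  proof (cases "i = 0")
    case True
    then show ?thesis
      by (simp add: heis_zero_basis form_ext_0_right)
  next
    case False
    then have i: "i > 0"
      using assms by simp
    have "heis B u i (fock_basis ({#(j, 0)#}, 0)) =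
        (\<Sum>l\<in>UNIV. if l = j then (if i = 1 then fock_scale (form_ext B u (axis j 1)) fock_vac else 0) else 0)"
      unfolding heis_pos_basis[OF i] using i
      by (intro sum.cong) (auto simp: fock_vac_def fock_exp_def)
    then show ?thesis
      by simp
  qed
  have v: "v = (\<Sum>j\<in>UNIV. v $ j *s axis j 1)"
    by (simp add: vec_eq_iff axis_def if_distrib cong: if_cong)
  have "form_ext B u v = (\<Sum>j\<in>UNIV. v $ j * form_ext B u (axis j 1))"
    by (subst v) (simp add: form_ext_sum_right form_ext_scale_right)
  then show ?thesis
    by (simp add: fock_vac_def fock_exp_def heis_neg_basis heis_sum heis_scale 1[unfolded fock_vac_def fock_exp_def]
        fock.scale_sum_left)
qed

text \<open>A nonzero mode changes the number of variables by one and with it the sign in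
  \<open>theta\<close>; the zero mode pairs with the lattice vector, which \<open>theta\<close>
  negates.\<close>

lemma theta_heis: "theta (heis B u m v) = - heis B u m (theta v)"
proof -
  have "(theta \<circ> heis B u m) v = ((\<lambda>v. - heis B u m v) \<circ> theta) v"
  proof (rule fock_hom_eqI[OF module_hom_compose[OF hom_heis hom_theta]
        module_hom_compose[OF hom_theta fock_pair.module_hom_neg[OF hom_heis]]])
    fix x :: "'a fock_index"
    obtain s \<mu> where x: "x = (s, \<mu>)"
      by (cases x)
    \<comment> \<open>If \<open>y\<close> does not occur, its count is 0 and both sides vanish;
      otherwise its removal lowers the size by one.\<close>
    have sz: "fock_scale (of_nat (count s y) * c) (fock_scale ((-1) ^ size (s - {#y#})) w) =
        - fock_scale ((-1) ^ size s) (fock_scale (of_nat (count s y) * c) w)" for y c w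
    proof (cases "y \<in># s")
      case True
      then obtain r where "s = add_mset y r"
        by (metis insert_DiffM)
      then show ?thesis
        by simp
    next
      case False
      then show ?thesis
        by (simp add: not_in_iff)
    qed
    consider "m < 0" | "m = 0" | "m > 0"
      by linarith
    then show "(theta \<circ> heis B u m) (fock_basis x) = ((\<lambda>v. - heis B u m v) \<circ> theta) (fock_basis x)"
    proof cases
      case 3
      then show ?thesis
        by (simp add: x heis_pos_basis theta_sum theta_scale theta_basis heis_scale fock.scale_sum_right sz
            sum_negf del: fock.scale_scale)
    qed (simp_all add: x heis_neg_basis heis_zero_basis theta_sum theta_scale theta_basis heis_scale
        fock.scale_sum_right lattice_vec_uminus form_ext_minus_right sum_negf algebra_simps)
  qed
  then show ?thesis
    by simp
qed

section \<open>Exponentials of Heisenberg modes\<close>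

lemma theta_series_power:
  assumes "\<And>m v. theta (A m v) = A' m (theta v)"
  shows "theta (series_power A j k v) = series_power A' j k (theta v)"
  by (induction j arbitrary: k) (simp_all add: theta_sum assms)

lemma theta_series_exp:
  assumes "\<And>m v. theta (A m v) = A' m (theta v)"
  shows "theta (series_exp A k v) = series_exp A' k (theta v)"
  unfolding series_exp_def by (simp add: theta_sum theta_scale theta_series_power[where A' = A', OF assms])

text \<open>The sign from \<open>theta_heis\<close> is absorbed by the lattice vector, which is why
  \<open>theta\<close> carries the exponentials for \<open>\<alpha>\<close> to those for
  \<open>- \<alpha>\<close>.\<close>

lemma theta_heis_lattice: "theta (heis B (lattice_vec \<alpha>) m v) = heis B (lattice_vec (- \<alpha>)) m (theta v)"
  using heis_scale_vec[of B "-1" "lattice_vec \<alpha>" m "theta v"]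
  by (simp add: theta_heis lattice_vec_uminus)

lemma theta_exp_neg: "theta (exp_neg B \<alpha> k v) = exp_neg B (- \<alpha>) k (theta v)"
  unfolding exp_neg_def by (intro theta_series_exp) (simp add: theta_scale theta_neg theta_heis_lattice)

lemma theta_exp_pos: "theta (exp_pos B \<alpha> k v) = exp_pos B (- \<alpha>) k (theta v)"
  unfolding exp_pos_def by (intro theta_series_exp) (simp add: theta_scale theta_neg theta_heis_lattice)

lemma series_power_vanish:
  assumes "\<And>m. 0 < m \<Longrightarrow> A m v = 0" "\<And>m. A m 0 = 0"
  shows "series_power A j k v = (if j = 0 \<and> k = 0 then v else 0)"
  by (induction j arbitrary: k) (auto simp: assms intro!: sum.neutral)

text \<open>Positive modes annihilate \<open>fock_exp \<mu>\<close>, which leaves the constant term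
  of the exponential.\<close>

lemma exp_pos_exp: "exp_pos B \<alpha> l (fock_exp \<mu>) = (if l = 0 then fock_exp \<mu> else 0)"
proof -
  have "exp_pos B \<alpha> l (fock_exp \<mu>) = (\<Sum>j\<le>l. if j = 0 then (if l = 0 then fock_exp \<mu> else 0) else 0)"
    unfolding exp_pos_def series_exp_def
    by (intro sum.cong refl, subst series_power_vanish) (auto simp: heis_pos_exp)
  then show ?thesis
    by simp
qed

lemma exp_neg_1: "exp_neg B \<alpha> 1 v = heis B (lattice_vec \<alpha>) (-1) v"
  by (simp add: exp_neg_def series_exp_def)

lemma heis_supported: "v \<in> fock_supported K \<Longrightarrow> heis B u m v \<in> fock_supported K"
proof (erule fock_supported_hom[OF _ hom_heis subspace_fock_supported])
  fix s \<alpha>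
  assume "\<alpha> \<in> K"
  then have basis: "fock_scale c (fock_basis (r, \<alpha>)) \<in> fock_supported K" for c r
    by (simp add: fock.subspace_scale[OF subspace_fock_supported] fock_basis_supported)
  consider "m < 0" | "m = 0" | "m > 0"
    by linarith
  then show "heis B u m (fock_basis (s, \<alpha>)) \<in> fock_supported K"
  proof cases
    case 1
    show ?thesis
      unfolding heis_neg_basis[OF 1] by (rule fock.subspace_sum[OF subspace_fock_supported basis])
  next
    case 2
    then show ?thesis
      by (simp add: heis_zero_basis basis)
  next
    case 3
    show ?thesis
      unfolding heis_pos_basis[OF 3] by (rule fock.subspace_sum[OF subspace_fock_supported basis])
  qed
qed

lemma hom_series_power:
  assumes "\<And>m. fock_hom (A m)"
  shows "fock_hom (series_power A j k)"
proof (induction j arbitrary: k)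
  case 0
  show ?case
    by (rule fock_homI) auto
next
  case (Suc j)
  show ?case
    by (rule fock_homI)
      (simp_all add: module_hom.add[OF Suc] module_hom.scale[OF Suc] module_hom.add[OF assms]
        module_hom.scale[OF assms] sum.distrib fock.scale_sum_right)
qed

lemma hom_series_exp:
  assumes "\<And>m. fock_hom (A m)"
  shows "fock_hom (series_exp A k)"
  unfolding series_exp_def
  by (intro fock_pair.module_hom_sum fock_pair.module_hom_scale hom_series_power assms) (simp add: fock.module_axioms)

lemma hom_exp_neg: "fock_hom (exp_neg B \<alpha> k)"
  unfolding exp_neg_def by (intro hom_series_exp fock_pair.module_hom_scale hom_heis)

lemma hom_exp_pos: "fock_hom (exp_pos B \<alpha> k)"
  unfolding exp_pos_def by (intro hom_series_exp fock_pair.module_hom_scale hom_heis)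


section \<open>The lattice and its dual basis\<close>

locale integral_lattice =
  fixes B :: "int ^ 'n \<Rightarrow> int ^ 'n \<Rightarrow> int"
  assumes nondegenerate: "nondegenerate_integral_lattice B"
begin

lemma B_add_left: "B (x + y) z = B x z + B y z"
  and B_sym: "B x y = B y x"
  and B_nondegenerate: "(\<And>y. B x y = 0) \<Longrightarrow> x = 0"
  using nondegenerate unfolding nondegenerate_integral_lattice_def by blast+

lemma B_add_right: "B z (x + y) = B z x + B z y"
  using B_add_left B_sym by metis

lemma B_0_left [simp]: "B 0 y = 0"
  using B_add_left[of 0 0 y] by simp

lemma B_0_right [simp]: "B y 0 = 0"
  using B_sym[of y 0] by simp

lemma B_minus_left [simp]: "B (- x) y = - B x y"
  using B_add_left[of x "- x" y] by simp

lemma B_minus_right [simp]: "B x (- y) = - B x y"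
  using B_sym[of x "- y"] B_sym[of x y] by simp

lemma B_scale_left: "B (c *s x) y = c * B x y"
proof (induction c rule: int_induct[of _ 0])
  case (step1 i)
  have "(i + 1) *s x = i *s x + x"
    by (simp add: vec_eq_iff algebra_simps)
  with step1 show ?case
    by (simp add: B_add_left algebra_simps)
next
  case (step2 i)
  have "(i - 1) *s x = i *s x + (- x)"
    by (simp add: vec_eq_iff algebra_simps)
  with step2 show ?case
    by (simp only: B_add_left B_minus_left) (simp add: algebra_simps)
qed simp

lemma B_sum_left: "B (\<Sum>i\<in>A. f i) y = (\<Sum>i\<in>A. B (f i) y)"
  by (induction A rule: infinite_finite_induct) (simp_all add: B_add_left)

lemma vec_expand: "(v :: 'a::comm_ring_1 ^ 'n) = (\<Sum>j\<in>UNIV. v $ j *s axis j 1)"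
  by (simp add: vec_eq_iff axis_def if_distrib cong: if_cong)

lemma B_expand: "B \<alpha> \<beta> = (\<Sum>i\<in>UNIV. \<Sum>j\<in>UNIV. \<alpha> $ i * \<beta> $ j * B (axis i 1) (axis j 1))"
proof -
  have 1: "B \<alpha> y = (\<Sum>i\<in>UNIV. \<alpha> $ i * B (axis i 1) y)" for \<alpha> y
    by (subst vec_expand[of \<alpha>]) (simp add: B_sum_left B_scale_left)
  have "B x \<beta> = (\<Sum>j\<in>UNIV. \<beta> $ j * B x (axis j 1))" for x
    using 1[of \<beta> x] B_sym by simp
  then have "B \<alpha> \<beta> = (\<Sum>i\<in>UNIV. \<alpha> $ i * (\<Sum>j\<in>UNIV. \<beta> $ j * B (axis i 1) (axis j 1)))"
    using 1[of \<alpha> \<beta>] by simp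
  then show ?thesis
    by (simp add: sum_distrib_left mult.assoc)
qed

lemma form_ext_lattice_vec:
  "form_ext B (lattice_vec \<alpha>) (lattice_vec \<beta>) = (of_int (B \<alpha> \<beta>) :: 'a::comm_ring_1)"
  by (simp add: form_ext_def lattice_vec_def B_expand[of \<alpha> \<beta>])

lemma form_ext_sym: "form_ext B u v = form_ext B v u"
  unfolding form_ext_def by (subst sum.swap) (simp add: B_sym mult.commute mult.left_commute)

lemma form_ext_axis: "form_ext B u v = (\<Sum>j\<in>UNIV. v $ j * form_ext B u (axis j 1))"
  by (subst vec_expand[of v]) (simp add: form_ext_sum_right form_ext_scale_right)

section \<open>Dual bases over the rationals and the complex numbers\<close>

lemma common_denominator: "\<exists>d>0. \<exists>\<alpha>. of_int d *s (x :: rat ^ 'n) = lattice_vec \<alpha>"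
proof -
  define d where "d = (\<Prod>i\<in>UNIV. snd (quotient_of (x $ i)))"
  have "d > 0"
    unfolding d_def by (intro prod_pos) (auto intro: quotient_of_denom_pos')
  have "\<exists>a. of_int d * x $ i = of_int a" for i
  proof -
    obtain p q where pq: "quotient_of (x $ i) = (p, q)"
      by (metis surj_pair)
    then have x: "x $ i = of_int p / of_int q" "q > 0"
      by (auto simp: quotient_of_div quotient_of_denom_pos)
    have "q dvd d"
      unfolding d_def using dvd_prodI[of UNIV i "\<lambda>i. snd (quotient_of (x $ i))"] pq by simp
    then obtain r where "d = q * r"
      by blast
    then have "of_int d * x $ i = of_int (r * p)"
      using x by simp
    then show ?thesis
      by blast
  qed
  then obtain a where "\<And>i. of_int d * x $ i = of_int (a i)"
    by metis
  then have "of_int d *s x = lattice_vec (\<chi> i. a i)"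
    by (simp add: vec_eq_iff lattice_vec_def)
  with \<open>d > 0\<close> show ?thesis
    by blast
qed

text \<open>Clearing denominators turns \<open>x\<close> into a lattice vector orthogonal to the
  whole lattice.\<close>

lemma form_ext_rat_nondegenerate:
  fixes x :: "rat ^ 'n"
  assumes "\<And>j. form_ext B x (axis j 1) = 0"
  shows "x = 0"
proof -
  obtain d \<alpha> where d: "d > 0" "of_int d *s x = lattice_vec \<alpha>"
    using common_denominator by blast
  have "B \<alpha> \<beta> = 0" for \<beta>
  proof -
    have "rat_of_int (B \<alpha> \<beta>) = of_int d * form_ext B x (lattice_vec \<beta>)"
      using form_ext_scale_left[of B "of_int d" x "lattice_vec \<beta>"] d
      by (simp add: form_ext_lattice_vec[symmetric])
    then show ?thesis
      using form_ext_axis[of x "lattice_vec \<beta>"] assms by simp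
  qed
  then have "\<alpha> = 0"
    by (rule B_nondegenerate)
  then have "of_int d * x $ i = 0" for i
    using d by (simp add: vec_eq_iff lattice_vec_def)
  then show ?thesis
    using d by (simp add: vec_eq_iff)
qed

text \<open>Nondegeneracy makes the Gram matrix injective. The rows of a left inverse are then the
  dual vectors, and nondegeneracy again gives the uniqueness that \<open>THE\<close>
  requires.\<close>

lemma form_ext_dual_basis: "form_ext B (dual_basis B i) (axis j 1) = (if i = j then 1 else 0)"
proof -
  define G :: "rat ^ 'n ^ 'n" where "G = (\<chi> i j. of_int (B (axis i 1) (axis j 1)))"
  have form: "form_ext B u (axis j 1) = (\<Sum>k\<in>UNIV. u $ k * G $ k $ j)" for u j
    by (simp add: form_ext_def G_def axis_def if_distrib if_distribR cong: if_cong)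
  have G_sym: "G $ k $ j = G $ j $ k" for k j
    using B_sym by (simp add: G_def)
  have "\<forall>x. G *v x = 0 \<longrightarrow> x = 0"
  proof (intro allI impI)
    fix x
    assume "G *v x = 0"
    then have "(\<Sum>k\<in>UNIV. G $ j $ k * x $ k) = 0" for j
      by (simp add: vec_eq_iff matrix_vector_mult_def)
    then show "x = 0"
      by (intro form_ext_rat_nondegenerate) (simp add: form G_sym mult.commute)
  qed
  then obtain D where D: "D ** G = mat 1"
    using matrix_left_invertible_ker by blast
  have "\<exists>!u. \<forall>j. form_ext B u (axis j 1) = (if i = j then 1 else 0 :: rat)"
  proof (rule ex_ex1I)
    have "(D ** G) $ i $ j = (if i = j then 1 else 0)" for j
      by (simp add: D mat_def)
    then have "\<forall>j. form_ext B (D $ i) (axis j 1) = (if i = j then 1 else 0)"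
      by (simp add: form matrix_matrix_mult_def)
    then show "\<exists>u. \<forall>j. form_ext B u (axis j 1) = (if i = j then 1 else 0 :: rat)"
      by blast
    fix u w
    assume "\<forall>j. form_ext B u (axis j 1) = (if i = j then 1 else 0 :: rat)"
      and "\<forall>j. form_ext B w (axis j 1) = (if i = j then 1 else 0 :: rat)"
    then have "u - w = 0"
      by (intro form_ext_rat_nondegenerate) (simp add: form_ext_diff_left)
    then show "u = w"
      by simp
  qed
  from theI'[OF this] show ?thesis
    unfolding dual_basis_def by blast
qed

definition dual :: "'n \<Rightarrow> complex ^ 'n"
  where "dual i = (\<chi> j. of_rat (dual_basis B i $ j))"

lemma form_ext_dual_axis: "form_ext B (dual i) (axis j 1) = (if i = j then 1 else 0)"
proof -
  have "form_ext B (dual i) (axis j 1) = of_rat (form_ext B (dual_basis B i) (axis j 1))"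
    by (simp add: form_ext_def dual_def of_rat_sum of_rat_mult axis_def if_distrib if_distribR cong: if_cong)
  then show ?thesis
    by (simp add: form_ext_dual_basis)
qed

lemma form_ext_dual: "form_ext B (dual i) u = u $ i"
  by (subst form_ext_axis) (simp add: form_ext_dual_axis if_distrib cong: if_cong)

lemma sum_dual_axis: "(\<Sum>i\<in>UNIV. form_ext B u (dual i) *s axis i 1) = u"
  using vec_expand[of u] by (simp add: form_ext_sym[of u] form_ext_dual)

text \<open>Together with \<open>sum_dual_axis\<close> this collapses the sums over dual pairs,
  which come from the conformal vector, to the single vector \<open>u\<close>.\<close>

lemma sum_axis_dual: "(\<Sum>i\<in>UNIV. form_ext B u (axis i 1) *s dual i) = u"
proof -
  define w where "w = (\<Sum>i\<in>UNIV. form_ext B u (axis i 1) *s dual i) - u"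
  have "form_ext B w (axis j 1) = 0" for j
    by (simp add: w_def form_ext_diff_left form_ext_sum_left form_ext_scale_left form_ext_dual_axis
        if_distrib cong: if_cong)
  \<comment> \<open>Coordinates are pairings with the dual vectors, so orthogonality to the basis
    forces all of them to vanish.\<close>
  then have "w $ i = 0" for i
    using form_ext_axis[of w "dual i"] by (simp add: form_ext_dual[symmetric] form_ext_sym[of w])
  then have "w = 0"
    by (simp add: vec_eq_iff)
  then show ?thesis
    by (simp add: w_def)
qed

lemma conformal_vector_eq: "conformal_vector B =
    fock_scale (1/2) (\<Sum>i\<in>UNIV. heis B (dual i) (-1) (heis B (axis i 1) (-1) fock_vac))"
  by (simp add: conformal_vector_def dual_def)

lemma theta_parity: "v \<in> fock_parity B p \<Longrightarrow> theta v \<in> fock_parity B p"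
proof -
  assume "v \<in> fock_parity B p"
  then have "theta v \<in> fock_supported (uminus ` {\<alpha>. of_int (B \<alpha> \<alpha>) = p})"
    unfolding fock_parity_def by (rule theta_supported)
  then show ?thesis
    unfolding fock_parity_def by (rule fock_supported_mono) auto
qed

lemma fock_basis_parity: "fock_basis (s, \<alpha>) \<in> fock_parity B (of_int (B \<alpha> \<alpha>))"
  by (simp add: fock_parity_def fock_basis_supported)

lemma subspace_fock_parity: "fock.subspace (fock_parity B p)"
  unfolding fock_parity_def by (rule subspace_fock_supported)

lemma theta_conformal: "theta (conformal_vector B) = conformal_vector B"
  by (simp add: conformal_vector_eq theta_scale theta_sum theta_heis heis_scale module_hom.neg[OF hom_heis] theta_vac)

end


section \<open>The vertex algebra of the lattice\<close>

locale lattice_vertex = integral_lattice B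
  for B :: "int ^ 'n \<Rightarrow> int ^ 'n \<Rightarrow> int" +
  fixes b :: "int ^ 'n \<Rightarrow> int ^ 'n \<Rightarrow> bit"
    and Y :: "'n fock \<Rightarrow> int \<Rightarrow> 'n fock \<Rightarrow> 'n fock"
  assumes cocycle: "lattice_cocycle B b"
    and vertex_structure: "lattice_vertex_structure B b Y"
begin

sublocale full_super_vertex_algebra fock_scale "fock_parity B" Y fock_vac
proof -
  interpret super_vertex_algebra fock_scale "fock_parity B" Y fock_vac
    using vertex_structure unfolding lattice_vertex_structure_def by blast
  have "v \<in> super_space (fock_parity B)" for v
    by (rule fock_hom_mem[OF fock_hom_ident subspace_space])
      (auto intro: base fock_basis_parity)
  then show "full_super_vertex_algebra fock_scale (fock_parity B) Y fock_vac"
    by unfold_locales auto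
qed

abbreviation gen :: "complex ^ 'n \<Rightarrow> 'n fock"
  where "gen u \<equiv> heis B u (-1) fock_vac"

abbreviation \<omega> :: "'n fock"
  where "\<omega> \<equiv> conformal_vector B"

lemma Y_gen: "Y (gen u) n v = heis B u n v"
  and Y_exp: "Y (fock_exp \<alpha>) n v = vertex_mode B b \<alpha> n v"
  using vertex_structure unfolding lattice_vertex_structure_def by blast+

lemma gen_even: "gen u \<in> fock_parity B 0"
  using vac_even unfolding fock_parity_def by (rule heis_supported)

lemma conformal_vector_even: "\<omega> \<in> fock_parity B 0"
  using vac_even unfolding conformal_vector_eq fock_parity_def
  by (intro fock.subspace_scale[OF subspace_fock_supported] fock.subspace_sum[OF subspace_fock_supported]
      heis_supported)

text \<open>Modulo 2 every value is its own negative. This lets \<open>theta\<close> pass the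
  operators \<open>exp_mult\<close> without a further sign.\<close>

lemma b_minus: "b (- \<alpha>) (- \<mu>) = b \<alpha> \<mu>"
proof -
  have add: "b (\<alpha> + \<mu>) \<nu> = b \<alpha> \<nu> + b \<mu> \<nu>" "b \<nu> (\<alpha> + \<mu>) = b \<nu> \<alpha> + b \<nu> \<mu>" for \<alpha> \<mu> \<nu>
    using cocycle unfolding lattice_cocycle_def by blast+
  have "b 0 \<nu> = 0" "b \<nu> 0 = 0" for \<nu>
    using add(1)[of 0 0 \<nu>] add(2)[of \<nu> 0 0] by simp_all
  then have "b (- \<alpha>) \<nu> = b \<alpha> \<nu>" "b \<nu> (- \<alpha>) = b \<nu> \<alpha>" for \<alpha> \<nu>
    using add(1)[of \<alpha> "- \<alpha>" \<nu>] add(2)[of \<nu> \<alpha> "- \<alpha>"] by (auto simp: add_eq_0_iff2)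
  then show ?thesis
    by simp
qed

lemma b_0_right: "b \<alpha> 0 = 0"
proof -
  have "b \<alpha> (0 + 0) = b \<alpha> 0 + b \<alpha> 0"
    using cocycle unfolding lattice_cocycle_def by blast
  then show ?thesis
    by simp
qed

section \<open>Commutation relations and the action of the conformal vector\<close>

lemma heis_commutator: "heis B u m (heis B w k c) - heis B w k (heis B u m c) =
    (if m + k = 0 then fock_scale (of_int m * form_ext B u w) c else 0)"
proof -
  \<comment> \<open>By \<open>heis_nonneg_one\<close> only the product of index 1 of two generators
    is nonzero, and it is a multiple of the vacuum.\<close>
  have "Y (gen u) m (Y (gen w) k c) - Y (gen w) k (Y (gen u) m c) =
      (\<Sum>i<2. fock_scale (of_int m gchoose i) (Y (Y (gen u) (int i) (gen w)) (m + k - int i) c))"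
    by (rule commutator[OF gen_even gen_even]) (auto simp: Y_gen heis_nonneg_one)
  then show ?thesis
    by (auto simp: Y_gen heis_nonneg_one numeral_2_eq_2 Y_left Y_vac)
qed

text \<open>Moving \<open>u(i)\<close> past the two factors of each summand gives two sums over dual
  pairs. Each collapses to \<open>u\<close>, and the factor 1/2 in \<open>\<omega>\<close>
  compensates for there being two.\<close>

lemma heis_conformal:
  assumes "0 \<le> i"
  shows "heis B u i \<omega> = (if i = 1 then gen u else 0)"
proof -
  have "heis B u i (heis B v (-1) (gen w)) =
      (if i = 1 then fock_scale (form_ext B u w) (gen v) + fock_scale (form_ext B u v) (gen w) else 0)" for v w
    using heis_commutator[of u i v "-1" "gen w"] assms
    by (auto simp: heis_nonneg_one heis_scale algebra_simps split: if_splits)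
  then have "heis B u i \<omega> = (if i = 1 then fock_scale (1/2)
      (heis B (\<Sum>i\<in>UNIV. form_ext B u (axis i 1) *s dual i) (-1) fock_vac
        + heis B (\<Sum>i\<in>UNIV. form_ext B u (dual i) *s axis i 1) (-1) fock_vac) else 0)"
    by (simp add: conformal_vector_eq heis_scale heis_sum heis_sum_vec sum.distrib)
  then show ?thesis
    by (simp only: sum_axis_dual sum_dual_axis fock_half)
qed

text \<open>The commutator formula is used with the generator in front, since its products with
  \<open>\<omega>\<close> are known from \<open>heis_conformal\<close>. The relation moves modes of
  \<open>\<omega>\<close> past creation operators.\<close>

lemma conformal_heis:
  "Y \<omega> k (heis B u m c) = heis B u m (Y \<omega> k c) - fock_scale (of_int m) (heis B u (m + k - 1) c)"
proof -
  have "Y (gen u) m (Y \<omega> k c) - Y \<omega> k (Y (gen u) m c) =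
      (\<Sum>i<2. fock_scale (of_int m gchoose i) (Y (Y (gen u) (int i) \<omega>) (m + k - int i) c))"
    by (rule commutator[OF gen_even conformal_vector_even]) (simp add: Y_gen heis_conformal)
  then show ?thesis
    by (simp add: Y_gen heis_conformal numeral_2_eq_2 Y_left algebra_simps)
qed

text \<open>The iterate formula at index -1 is the normally ordered product. On
  \<open>fock_exp \<alpha>\<close> its terms with \<open>i > 0\<close> vanish, each of them applying
  a positive mode first.\<close>

lemma normal_product_exp:
  assumes "0 \<le> k"
  shows "Y (heis B u (-1) (gen w)) k (fock_exp \<alpha>) =
    heis B u (-1) (heis B w k (fock_exp \<alpha>)) + heis B w (k - 1) (heis B u 0 (fock_exp \<alpha>))"
proof -
  have "Y (Y (gen u) (-1) (gen w)) k (fock_exp \<alpha>) = (\<Sum>i<1::nat. fock_scale ((-1) ^ i * (of_int (-1) gchoose i))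
        (Y (gen u) (-1 - int i) (Y (gen w) (k + int i) (fock_exp \<alpha>))
          - fock_scale ((-1) powi (-1)) (Y (gen w) (-1 + k - int i) (Y (gen u) (int i) (fock_exp \<alpha>)))))"
    by (subst iterate[OF gen_even gen_even], intro Sum_any_eq_sum_lessThan)
      (use assms in \<open>simp add: Y_gen heis_pos_exp\<close>)
  then show ?thesis
    by (simp add: Y_gen power_int_minus)
qed

lemma conformal_exp_0: "Y \<omega> 0 (fock_exp \<alpha>) = heis B (lattice_vec \<alpha>) (-1) (fock_exp \<alpha>)"
proof -
  have "Y \<omega> 0 (fock_exp \<alpha>) = fock_scale (1/2)
      (heis B (\<Sum>i\<in>UNIV. form_ext B (lattice_vec \<alpha>) (axis i 1) *s dual i) (-1) (fock_exp \<alpha>)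
        + heis B (\<Sum>i\<in>UNIV. form_ext B (lattice_vec \<alpha>) (dual i) *s axis i 1) (-1) (fock_exp \<alpha>))"
    by (simp add: conformal_vector_eq Y_left normal_product_exp heis_zero_exp heis_scale heis_sum_vec sum.distrib
        form_ext_sym[of "lattice_vec \<alpha>"])
  then show ?thesis
    by (simp only: sum_axis_dual sum_dual_axis fock_half)
qed

text \<open>Only the zero modes contribute to the normally ordered products, and the sum over dual
  pairs of the pairings with \<open>\<alpha>\<close> is its length squared.\<close>

lemma conformal_exp_1: "Y \<omega> 1 (fock_exp \<alpha>) = fock_scale (of_int (B \<alpha> \<alpha>) / 2) (fock_exp \<alpha>)"
proof -
  have "(\<Sum>i\<in>UNIV. form_ext B (dual i) (lattice_vec \<alpha>) * form_ext B (axis i 1) (lattice_vec \<alpha>)) =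
      form_ext B (\<Sum>i\<in>UNIV. form_ext B (lattice_vec \<alpha>) (axis i 1) *s dual i) (lattice_vec \<alpha>)"
    by (simp add: form_ext_sum_left form_ext_scale_left form_ext_sym[of "lattice_vec \<alpha>"] mult.commute)
  also have "\<dots> = of_int (B \<alpha> \<alpha>)"
    by (simp add: sum_axis_dual form_ext_lattice_vec)
  finally show ?thesis
    by (simp add: conformal_vector_eq Y_left normal_product_exp heis_zero_exp heis_pos_exp heis_scale
        fock.scale_sum_left[symmetric] mult.commute)
qed

text \<open>The mode of index -2 is the coefficient of \<open>z\<close>. The positive exponential
  acts on \<open>fock_exp \<alpha>\<close> as 1, so this is the linear term of the negative
  exponential.\<close>

lemma exp_translation: "Y (fock_exp \<alpha>) (-2) fock_vac = heis B (lattice_vec \<alpha>) (-1) (fock_exp \<alpha>)"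
proof -
  have neg0: "exp_neg B \<alpha> k 0 = 0" for k
    unfolding exp_neg_def series_exp_def by (subst series_power_vanish) auto
  have "Y (fock_exp \<alpha>) (-2) fock_vac =
      Sum_any (\<lambda>l::nat. exp_neg B \<alpha> (nat (1 + int l)) (exp_pos B \<alpha> l (fock_exp \<alpha>)))"
    unfolding Y_exp vertex_mode_def
    by (simp add: fock_vac_def fock_exp_def exp_mult_def b_0_right bit_sign_def)
  also have "\<dots> = (\<Sum>l<1. exp_neg B \<alpha> (nat (1 + int l)) (exp_pos B \<alpha> l (fock_exp \<alpha>)))"
    by (intro Sum_any_eq_sum_lessThan) (simp add: exp_pos_exp neg0)
  finally show ?thesis
    using exp_neg_1[of B \<alpha> "fock_exp \<alpha>"] by (simp add: exp_pos_exp)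
qed

text \<open>Both sides obey the same recursion under creation operators, by
  \<open>conformal_heis\<close> on the left and \<open>translation_product\<close> on the right, and
  they agree on \<open>fock_exp \<mu>\<close>.\<close>

lemma translation_conformal: "Y \<omega> 0 a = Y a (-2) fock_vac"
proof (rule fock_hom_eqI[OF hom_right hom_left])
  fix x :: "'n fock_index"
  obtain s \<mu> where x: "x = (s, \<mu>)"
    by (cases x)
  have "Y \<omega> 0 (fock_basis (s, \<mu>)) = Y (fock_basis (s, \<mu>)) (-2) fock_vac"
  proof (induction s)
    case empty
    then show ?case
      using conformal_exp_0 exp_translation by (simp add: fock_exp_def)
  next
    case (add y s)
    obtain i k where y: "y = (i, k)"
      by (cases y)
    have "Y (fock_basis (add_mset y s, \<mu>)) (-2) fock_vac =
        Y (Y (gen (axis i 1)) (- 1 - int k) (fock_basis (s, \<mu>))) (-2) fock_vac"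
      by (simp add: y fock_basis_add_mset[of _ _ _ _ B] Y_gen)
    also have "\<dots> = heis B (axis i 1) (- 1 - int k) (Y \<omega> 0 (fock_basis (s, \<mu>)))
        - fock_scale (of_int (- 1 - int k)) (heis B (axis i 1) (- 1 - int k - 1) (fock_basis (s, \<mu>)))"
      unfolding translation_product[OF gen_even fock_basis_parity] by (simp add: Y_gen add.IH)
    finally show ?case
      by (simp add: y fock_basis_add_mset[of _ _ _ _ B] conformal_heis)
  qed
  then show "Y \<omega> 0 (fock_basis x) = Y (fock_basis x) (-2) fock_vac"
    by (simp add: x)
qed

text \<open>The conformal weight; \<open>Suc\<close> undoes the shift in the indexing of the
  negative modes.\<close>

definition weight :: "'n fock_index \<Rightarrow> rat"
  where "weight = (\<lambda>(s, \<alpha>). of_nat (\<Sum>x\<in>#s. Suc (snd x)) + of_int (B \<alpha> \<alpha>) / 2)"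

lemma conformal_weight: "Y \<omega> 1 (fock_basis x) = fock_scale (of_rat (weight x)) (fock_basis x)"
proof -
  obtain s \<mu> where x: "x = (s, \<mu>)"
    by (cases x)
  have "Y \<omega> 1 (fock_basis (s, \<mu>)) = fock_scale (of_rat (weight (s, \<mu>))) (fock_basis (s, \<mu>))"
  proof (induction s)
    case empty
    then show ?case
      using conformal_exp_1 by (simp add: fock_exp_def weight_def of_rat_divide)
  next
    case (add y s)
    obtain i k where y: "y = (i, k)"
      by (cases y)
    let ?h = "heis B (axis i 1) (- 1 - int k) (fock_basis (s, \<mu>))"
    have "weight (add_mset y s, \<mu>) = weight (s, \<mu>) + of_nat (Suc k)"
      by (simp add: y weight_def)
    then have w: "of_rat (weight (add_mset y s, \<mu>)) = (of_rat (weight (s, \<mu>)) - of_int (- 1 - int k) :: complex)"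
      by (simp add: of_rat_add)
    \<comment> \<open>At \<open>k = 1\<close> the relation \<open>conformal_heis\<close> says that a
      mode \<open>u(m)\<close> shifts the weight by \<open>- m\<close>.\<close>
    have "Y \<omega> 1 ?h = fock_scale (of_rat (weight (s, \<mu>))) ?h - fock_scale (of_int (- 1 - int k)) ?h"
      by (simp only: conformal_heis add.IH heis_scale add_diff_cancel_right')
    also have "\<dots> = fock_scale (of_rat (weight (add_mset y s, \<mu>))) ?h"
      by (simp only: w fock.scale_left_diff_distrib)
    finally show ?case
      by (simp add: y fock_basis_add_mset[of _ _ _ _ B])
  qed
  then show ?thesis
    by (simp add: x)
qed

lemma lookup_conformal:
  "Poly_Mapping.lookup (Y \<omega> 1 v) x = of_rat (weight x) * Poly_Mapping.lookup v x"
  by (rule lookup_diagonal[OF hom_right conformal_weight])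

text \<open>The mode of \<open>\<omega>\<close> is moved past the two creation operators of each
  summand. At index 3 every dual pair contributes its pairing 1, so the central charge is the
  rank.\<close>

lemma conformal_conformal:
  assumes "1 \<le> n"
  shows "Y \<omega> n \<omega> = (if n = 1 then fock_scale 2 \<omega> else if n = 3 then fock_scale (of_nat CARD('n) / 2) fock_vac else 0)"
proof -
  have 0: "heis B w j fock_vac = 0" if "0 \<le> j" for w j
    using that by (cases "j = 0") (auto simp: fock_vac_def heis_zero_exp heis_pos_exp form_ext_0_right)
  have vac: "Y \<omega> n fock_vac = 0"
    using assms by (simp add: creation_nonneg full)
  have "Y \<omega> n (heis B v (-1) (gen w)) = heis B v (-1) (heis B w (n - 2) fock_vac) + heis B v (n - 2) (gen w)" for v w
    by (simp add: conformal_heis vac heis_add)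
  also have "heis B v (-1) (heis B w (n - 2) fock_vac) + heis B v (n - 2) (gen w) =
      (if n = 1 then fock_scale 2 (heis B v (-1) (gen w)) else if n = 3 then fock_scale (form_ext B v w) fock_vac else 0)" for v w
    using assms fock.scale_left_distrib[of 1 1 "heis B v (-1) (gen w)"]
    by (auto simp: 0 heis_nonneg_one)
  finally have "Y \<omega> n (heis B v (-1) (gen w)) =
      (if n = 1 then fock_scale 2 (heis B v (-1) (gen w)) else if n = 3 then fock_scale (form_ext B v w) fock_vac else 0)" for v w .
  moreover have half: "(\<Sum>i\<in>(UNIV :: 'n set). 1 / 2) * 2 = (of_nat CARD('n) :: complex)"
    by simp
  ultimately show ?thesis
    by (auto simp: conformal_vector_eq Y_right fock.scale_sum_right form_ext_dual_axis fock.scale_sum_left[symmetric]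
        half simp del: sum_constant)
qed

lemma virasoro_lattice: "vir_mode Y \<omega> m (vir_mode Y \<omega> n v) - vir_mode Y \<omega> n (vir_mode Y \<omega> m v) =
    fock_scale (of_int (m - n)) (vir_mode Y \<omega> (m + n) v)
      + (if m + n = 0 then fock_scale (of_int (m ^ 3 - m) / 12 * of_nat CARD('n)) v else 0)"
  by (rule virasoro_relations[OF conformal_vector_even]) (auto simp: conformal_conformal translation_conformal)

section \<open>The grading by the lattice\<close>

lemma lattice_vec_eqI:
  assumes "\<And>u. form_ext B u (lattice_vec \<alpha>) = form_ext B u (lattice_vec \<beta> :: complex ^ 'n)"
  shows "\<alpha> = \<beta>"
  using assms[of "dual i" for i] by (simp add: form_ext_dual lattice_vec_def vec_eq_iff)

text \<open>Every \<open>u(0)\<close> is a derivation, so the product is a simultaneous eigenvector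
  with eigenvalues given by pairing with \<open>\<alpha> + \<beta>\<close>; by nondegeneracy these
  eigenvalues determine the lattice vector.\<close>

lemma Y_basis_supported: "Y (fock_basis (s, \<alpha>)) n (fock_basis (t, \<beta>)) \<in> fock_supported {\<alpha> + \<beta>}"
proof -
  let ?w = "Y (fock_basis (s, \<alpha>)) n (fock_basis (t, \<beta>))"
  have eig: "heis B u 0 ?w = fock_scale (form_ext B u (lattice_vec (\<alpha> + \<beta>))) ?w" for u
    using derivation[OF gen_even fock_basis_parity, of u s \<alpha> n "fock_basis (t, \<beta>)"]
    by (simp add: Y_gen heis_zero_basis Y_left Y_right lattice_vec_add form_ext_add_right fock.scale_left_distrib)
  have "\<gamma> = \<alpha> + \<beta>" if "(r, \<gamma>) \<in> Poly_Mapping.keys ?w" for r \<gamma>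
  proof (rule lattice_vec_eqI)
    fix u
    have "heis B u 0 (fock_basis x) = fock_scale (form_ext B u (lattice_vec (snd x))) (fock_basis x)" for x
      using heis_zero_basis[of B u "fst x" "snd x"] by simp
    from lookup_diagonal[OF hom_heis this, of ?w "(r, \<gamma>)"]
    have "form_ext B u (lattice_vec (\<alpha> + \<beta>)) * Poly_Mapping.lookup ?w (r, \<gamma>) =
        form_ext B u (lattice_vec \<gamma>) * Poly_Mapping.lookup ?w (r, \<gamma>)"
      by (simp add: eig lookup_fock_scale)
    then show "form_ext B u (lattice_vec \<gamma>) = form_ext B u (lattice_vec (\<alpha> + \<beta>))"
      using that by (simp add: in_keys_iff)
  qed
  then show ?thesis
    unfolding fock_supported_def by auto
qed

lemma Y_supported:
  assumes "a \<in> fock_supported K" "c \<in> fock_supported K'" "\<And>\<alpha> \<beta>. \<alpha> \<in> K \<Longrightarrow> \<beta> \<in> K' \<Longrightarrow> \<alpha> + \<beta> \<in> K''"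
  shows "Y a n c \<in> fock_supported K''"
proof (rule fock_supported_hom[OF assms(1) hom_left subspace_fock_supported])
  fix s \<alpha>
  assume \<alpha>: "\<alpha> \<in> K"
  show "Y (fock_basis (s, \<alpha>)) n c \<in> fock_supported K''"
  proof (rule fock_supported_hom[OF assms(2) hom_right subspace_fock_supported])
    fix t \<beta>
    assume "\<beta> \<in> K'"
    with \<alpha> assms(3) show "Y (fock_basis (s, \<alpha>)) n (fock_basis (t, \<beta>)) \<in> fock_supported K''"
      using fock_supported_mono[OF Y_basis_supported] by simp
  qed
qed

section \<open>The involution is an automorphism\<close>

lemma theta_vertex_mode: "theta (vertex_mode B b \<alpha> n v) = vertex_mode B b (- \<alpha>) n (theta v)"
proof -
  have hom: "fock_hom (vertex_mode B b \<beta> n)" for \<beta>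
    unfolding vertex_mode_def by (rule hom_lin_ext)
  have "(theta \<circ> vertex_mode B b \<alpha> n) v = (vertex_mode B b (- \<alpha>) n \<circ> theta) v"
  proof (rule fock_hom_eqI[OF module_hom_compose[OF hom hom_theta] module_hom_compose[OF hom_theta hom]])
    fix x :: "'n fock_index"
    obtain s \<mu> where x: "x = (s, \<mu>)"
      by (cases x)
    let ?e = "(-1) ^ size s :: complex" and ?x = "fock_basis (s, - \<mu>)"
    \<comment> \<open>The summand for \<open>- \<alpha>\<close> at \<open>- \<mu>\<close>; the power
      of \<open>z\<close> is written with \<open>B \<alpha> \<mu>\<close>, since negating both
      arguments does not change the form.\<close>
    let ?E = "\<lambda>l v. let k = int l - B \<alpha> \<mu> - n - 1 in if k < 0 then 0
      else exp_neg B (- \<alpha>) (nat k) (exp_pos B (- \<alpha>) l (exp_mult b (- \<alpha>) v))"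
    have E: "?E l (fock_scale ?e v) = fock_scale ?e (?E l v)" for l v
      by (simp add: Let_def exp_mult_def module_hom.scale[OF hom_lin_ext] module_hom.scale[OF hom_exp_neg]
          module_hom.scale[OF hom_exp_pos])
    \<comment> \<open>The scalar is a sign, so scaling by it is injective and passes through
      \<open>Sum_any\<close>.\<close>
    have hom_e: "fock_hom (fock_scale ?e)" and inj_e: "inj (fock_scale ?e)"
      by (auto intro!: fock_homI injI simp: fock.scale_right_distrib mult.commute)
    have diff: "- \<alpha> - \<mu> = - \<mu> - \<alpha>"
      by simp
    have "theta (exp_mult b \<alpha> (fock_basis (s, \<mu>))) = exp_mult b (- \<alpha>) (fock_scale ?e ?x)"
      by (simp add: exp_mult_def theta_scale theta_basis b_minus module_hom.scale[OF hom_lin_ext] mult.commute diff)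
    then have "theta (vertex_mode B b \<alpha> n (fock_basis x)) = Sum_any (\<lambda>l. ?E l (fock_scale ?e ?x))"
      unfolding vertex_mode_def x
      by (simp add: theta_Sum_any Let_def if_distrib[of theta] theta_exp_neg theta_exp_pos cong: if_cong)
    also have "\<dots> = fock_scale ?e (Sum_any (\<lambda>l. ?E l ?x))"
      by (simp only: E module_hom.Sum_any_inj[OF hom_e inj_e])
    also have "\<dots> = vertex_mode B b (- \<alpha>) n (theta (fock_basis x))"
      unfolding vertex_mode_def x theta_basis module_hom.scale[OF hom_lin_ext] by (simp cong: if_cong)
    finally show "(theta \<circ> vertex_mode B b \<alpha> n) (fock_basis x) = (vertex_mode B b (- \<alpha>) n \<circ> theta) (fock_basis x)"
      by simp
  qed
  then show ?thesis
    by simp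
qed

text \<open>The iterate formula removes one creation operator and leaves fields of a generator and
  of a smaller basis element. The sign from the generator is absorbed by replacing \<open>u\<close>
  with \<open>- u\<close>, and the same formula reassembles the result.\<close>

lemma theta_Y_basis:
  "theta (Y (fock_basis (s, \<alpha>)) n v) = Y (theta (fock_basis (s, \<alpha>))) n (theta v)"
\<comment> \<open>The iterate formula involves other modes and other arguments, hence the
  generalization over \<open>n\<close> and \<open>v\<close>.\<close>
proof (induction s arbitrary: n v)
  case empty
  then show ?case
    using theta_vertex_mode[of \<alpha> n v] Y_exp[of \<alpha> n v] Y_exp[of "- \<alpha>" n "theta v"]
    by (simp add: fock_exp_def theta_basis)
next
  case (add y s)
  obtain i k where y: "y = (i, k)"
    by (cases y)
  let ?u = "axis i 1 :: complex ^ 'n" and ?c = "fock_basis (s, \<alpha>)" and ?m = "- 1 - int k"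
  have \<theta>heis: "theta (heis B u m v) = heis B (- u) m (theta v)" for u m v
    using heis_scale_vec[of B "-1" u m "theta v"] by (simp add: theta_heis)
  have "theta (Y (fock_basis (add_mset y s, \<alpha>)) n v) = theta (Y (Y (gen ?u) ?m ?c) n v)"
    by (simp add: y fock_basis_add_mset[of _ _ _ _ B] Y_gen)
  also have "\<dots> = Sum_any (\<lambda>i::nat. fock_scale ((-1) ^ i * (of_int ?m gchoose i))
        (Y (gen (- ?u)) (?m - int i) (Y (theta ?c) (n + int i) (theta v))
          - fock_scale ((-1) powi ?m) (Y (theta ?c) (?m + n - int i) (Y (gen (- ?u)) (int i) (theta v)))))"
    unfolding iterate[OF gen_even fock_basis_parity] theta_Sum_any
    by (simp only: theta_scale theta_diff Y_gen \<theta>heis add.IH)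
  also have "\<dots> = Y (Y (gen (- ?u)) ?m (theta ?c)) n (theta v)"
    by (rule iterate[OF gen_even theta_parity[OF fock_basis_parity], symmetric])
  also have "\<dots> = Y (theta (fock_basis (add_mset y s, \<alpha>))) n (theta v)"
    by (simp add: y fock_basis_add_mset[of _ _ _ _ B] Y_gen \<theta>heis)
  finally show ?case .
qed

theorem theta_Y: "theta (Y a n v) = Y (theta a) n (theta v)"
proof -
  have "(theta \<circ> (\<lambda>a. Y a n v)) a = ((\<lambda>a. Y a n (theta v)) \<circ> theta) a"
    by (rule fock_hom_eqI[OF module_hom_compose[OF hom_left hom_theta] module_hom_compose[OF hom_theta hom_left]])
      (auto simp: theta_Y_basis)
  then show ?thesis
    by simp
qed

end


section \<open>The cone construction\<close>

lemma lattice_points_P: "\<alpha> \<in> lattice_points cone_P \<longleftrightarrow> (\<forall>i. 0 \<le> \<alpha> $ i)"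
  and lattice_points_N: "\<alpha> \<in> lattice_points cone_N \<longleftrightarrow> (\<forall>i. \<alpha> $ i < 0)"
  and lattice_points_D: "lattice_points cone_D = lattice_points cone_P \<union> lattice_points cone_N"
  by (auto simp: lattice_points_def cone_P_def cone_N_def cone_D_def lattice_vec_def)

lemma lattice_points_disjoint: "lattice_points cone_P \<inter> lattice_points cone_N = {}"
  by (auto simp: lattice_points_P lattice_points_N) (meson not_less)

text \<open>The map \<open>\<phi>\<^sub>s\<close> of the introduction, with \<open>True\<close> for
  \<open>s = 1\<close> and \<open>False\<close> for \<open>s = -1\<close>.\<close>

definition cone_embedding :: "bool \<Rightarrow> 'n::finite fock \<Rightarrow> 'n fock"
  where "cone_embedding s a = fock_proj (lattice_points cone_P) a
    + fock_scale (if s then 1 else -1) (theta (fock_proj (lattice_points cone_N) a))"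

lemma hom_cone_embedding: "fock_hom (cone_embedding s)"
  by (rule fock_homI)
    (simp_all add: cone_embedding_def module_hom.add[OF hom_fock_proj] module_hom.scale[OF hom_fock_proj]
      theta_add theta_scale fock.scale_right_distrib)

context lattice_vertex
begin

abbreviation "LP \<equiv> lattice_points cone_P :: (int ^ 'n) set"
abbreviation "LN \<equiv> lattice_points cone_N :: (int ^ 'n) set"

text \<open>Every basis vector has a definite parity, so no vector is lost by splitting the support
  space into its two parity parts.\<close>

lemma super_space_cone: "super_space (cone_space B) = fock_supported (lattice_points cone_D)"
proof
  have sub: "fock.subspace (cone_space B p)" for p
    unfolding cone_space_def fock_parity_def fock_supported_Int by (rule subspace_fock_supported)
  show "super_space (cone_space B) \<subseteq> fock_supported (lattice_points cone_D)"
    by (auto simp: super_space_def cone_space_def intro: fock.subspace_add[OF subspace_fock_supported])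
  show "fock_supported (lattice_points cone_D) \<subseteq> super_space (cone_space B)"
  proof
    fix v :: "'n fock"
    assume "v \<in> fock_supported (lattice_points cone_D)"
    then show "v \<in> super_space (cone_space B)"
    proof (rule fock_supported_hom[OF _ fock_hom_ident fock.subspace_super_space[of "cone_space B", OF sub]])
      fix s :: "('n \<times> nat) multiset" and \<alpha> :: "int ^ 'n"
      assume "\<alpha> \<in> lattice_points cone_D"
      then have "fock_basis (s, \<alpha>) \<in> cone_space B (of_int (B \<alpha> \<alpha>))"
        by (simp add: cone_space_def fock_basis_parity fock_basis_supported)
      then show "fock_basis (s, \<alpha>) \<in> super_space (cone_space B)"
        by (rule fock.super_space_base[of "cone_space B", OF sub])
    qed
  qed
qed

text \<open>The four terms are grouped by the half of the cone that supports them. The mixed terms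
  land in \<open>LN\<close> because a strictly negative plus a nonpositive coordinate is strictly
  negative; \<open>theta\<close> sends the product of two elements from \<open>LN\<close> to the
  side of \<open>LP\<close>.\<close>

lemma cone_Y_parts:
  fixes a c n
  defines "aP \<equiv> fock_proj LP a" and "aN \<equiv> fock_proj LN a" and "cP \<equiv> fock_proj LP c" and "cN \<equiv> fock_proj LN c"
  shows "cone_Y Y a n c = (Y aP n cP + theta (Y aN n cN)) + (Y (theta aP) n cN + Y aN n (theta cP))"
    and "Y aP n cP + theta (Y aN n cN) \<in> fock_supported LP"
    and "Y (theta aP) n cN + Y aN n (theta cP) \<in> fock_supported LN"
proof -
  show "cone_Y Y a n c = (Y aP n cP + theta (Y aN n cN)) + (Y (theta aP) n cN + Y aN n (theta cP))"
    by (simp add: cone_Y_def Let_def aP_def aN_def cP_def cN_def algebra_simps)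
  have P: "aP \<in> fock_supported LP" "cP \<in> fock_supported LP" and N: "aN \<in> fock_supported LN" "cN \<in> fock_supported LN"
    unfolding aP_def aN_def cP_def cN_def by (rule fock_proj_supported)+
  have "Y aP n cP \<in> fock_supported LP"
    by (rule Y_supported[OF P]) (simp add: lattice_points_P)
  moreover have "theta (Y aN n cN) \<in> fock_supported LP"
    unfolding theta_Y
  proof (rule Y_supported[OF theta_supported[OF N(1)] theta_supported[OF N(2)]])
    fix \<alpha> \<beta>
    assume "\<alpha> \<in> uminus ` LN" "\<beta> \<in> uminus ` LN"
    then have "0 \<le> \<alpha> $ i" "0 \<le> \<beta> $ i" for i
      by (auto simp: lattice_points_N less_imp_le)
    then show "\<alpha> + \<beta> \<in> LP"
      by (simp add: lattice_points_P)
  qed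
  ultimately show "Y aP n cP + theta (Y aN n cN) \<in> fock_supported LP"
    by (rule fock.subspace_add[OF subspace_fock_supported])
  have "Y (theta aP) n cN \<in> fock_supported LN"
    by (rule Y_supported[OF theta_supported[OF P(1)] N(2)])
      (auto simp: lattice_points_P lattice_points_N, meson less_le_trans)
  moreover have "Y aN n (theta cP) \<in> fock_supported LN"
    by (rule Y_supported[OF N(1) theta_supported[OF P(2)]])
      (auto simp: lattice_points_P lattice_points_N, meson less_le_trans)
  ultimately show "Y (theta aP) n cN + Y aN n (theta cP) \<in> fock_supported LN"
    by (rule fock.subspace_add[OF subspace_fock_supported])
qed

lemma supported_P_D: "v \<in> fock_supported LP \<Longrightarrow> v \<in> fock_supported (lattice_points cone_D)"
  and supported_N_D: "v \<in> fock_supported LN \<Longrightarrow> v \<in> fock_supported (lattice_points cone_D)"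
  by (auto simp: lattice_points_D elim!: fock_supported_mono)

lemma cone_Y_supported: "cone_Y Y a n c \<in> fock_supported (lattice_points cone_D)"
  unfolding cone_Y_parts(1)
  by (intro fock.subspace_add[OF subspace_fock_supported] supported_P_D[OF cone_Y_parts(2)]
      supported_N_D[OF cone_Y_parts(3)])

lemma fock_proj_parity: "v \<in> fock_parity B p \<Longrightarrow> fock_proj K v \<in> fock_parity B p"
  unfolding fock_parity_def by (rule fock_proj_supported_other)

lemma fock_proj_sum:
  assumes "v \<in> fock_supported LP" "w \<in> fock_supported LN"
  shows "fock_proj LP (v + w) = v" "fock_proj LN (v + w) = w"
  using fock_proj_disjoint[OF assms(1), of LN] fock_proj_disjoint[OF assms(2), of LP] lattice_points_disjoint
  by (simp_all add: module_hom.add[OF hom_fock_proj] fock_proj_id[OF assms(1)] fock_proj_id[OF assms(2)] Int_commute)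

lemma cone_embedding_P: "v \<in> fock_supported LP \<Longrightarrow> cone_embedding s v = v"
  using fock_proj_sum[of v 0] by (simp add: cone_embedding_def fock.subspace_0[OF subspace_fock_supported])

text \<open>Expanding the right-hand side gives the four defining cases: a term with one factor from
  \<open>LN\<close> carries the sign \<open>s\<close>, a term with two carries
  \<open>s * s = 1\<close>, and \<open>theta_Y\<close> distributes \<open>theta\<close> over
  products.\<close>

lemma cone_embedding_mult: "cone_embedding s (cone_Y Y a n c) = Y (cone_embedding s a) n (cone_embedding s c)"
  unfolding cone_embedding_def cone_Y_parts(1) fock_proj_sum[OF cone_Y_parts(2,3)]
  by (cases s) (simp_all add: theta_add theta_Y Y_left Y_right algebra_simps)

text \<open>Sum and difference of the two images recover both components. One sign would not do: if
  all coordinates of \<open>\<alpha>\<close> are positive, \<open>fock_exp \<alpha>\<close> and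
  \<open>fock_exp (- \<alpha>)\<close> have the same image under
  \<open>cone_embedding True\<close>.\<close>

lemma cone_embedding_inj:
  fixes v :: "'n fock"
  assumes "v \<in> fock_supported (lattice_points cone_D)" "\<And>s. cone_embedding s v = 0"
  shows "v = 0"
proof -
  define p q where "p = fock_proj LP v" and "q = fock_proj LN v"
  have pq: "p + theta q = 0" "p - theta q = 0"
    using assms(2)[of True] assms(2)[of False] by (simp_all add: cone_embedding_def p_def q_def)
  then have "p + p = 0"
    by (simp add: add_eq_0_iff)
  then have "p = 0"
    using fock_half[of p] by simp
  then have "q = 0"
    using pq theta_theta[of q] by simp
  have "p + q = v"
    unfolding p_def q_def using assms(1) lattice_points_disjoint by (intro fock_proj_Un) (simp_all add: lattice_points_D)
  then show ?thesis
    by (simp add: \<open>p = 0\<close> \<open>q = 0\<close>)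
qed

lemma zero_P: "fock_supported {0} \<subseteq> fock_supported LP"
  by (auto simp: lattice_points_P elim!: fock_supported_mono)

lemma vac_supported: "fock_vac \<in> fock_supported {0}"
  by (simp add: fock_vac_def fock_exp_def fock_basis_supported)

lemma conformal_supported: "\<omega> \<in> fock_supported {0}"
  unfolding conformal_vector_eq
  by (intro fock.subspace_scale[OF subspace_fock_supported] fock.subspace_sum[OF subspace_fock_supported]
      heis_supported vac_supported)

sublocale cone: super_vertex_algebra_embedding fock_scale "fock_parity B" Y fock_vac "cone_space B" "cone_Y Y" cone_embedding
proof unfold_locales
  show "fock.subspace (cone_space B p)" for p
    unfolding cone_space_def fock_parity_def fock_supported_Int by (rule subspace_fock_supported)
  show "cone_Y Y a n c \<in> cone_space B (p + q)" if "a \<in> cone_space B p" "c \<in> cone_space B q" for a p c q n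
  proof -
    have "cone_Y Y a n c \<in> fock_parity B (p + q)"
      using that unfolding cone_space_def cone_Y_parts(1)
      by (intro fock.subspace_add[OF subspace_fock_parity] theta_parity)
        (auto intro: parity theta_parity fock_proj_parity simp del: add_bit_eq_xor)
    then show ?thesis
      using cone_Y_supported[of a n c] by (simp add: cone_space_def)
  qed
  show "cone_embedding s (v + w) = cone_embedding s v + cone_embedding s w"
    "cone_embedding s (fock_scale c v) = fock_scale c (cone_embedding s v)" for s c v w
    by (simp_all add: module_hom.add[OF hom_cone_embedding] module_hom.scale[OF hom_cone_embedding])
  show "cone_embedding s a \<in> fock_parity B p" if "a \<in> cone_space B p" for s a p
    using that unfolding cone_space_def cone_embedding_def
    by (intro fock.subspace_add[OF subspace_fock_parity] fock.subspace_scale[OF subspace_fock_parity]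
        theta_parity fock_proj_parity) auto
  show "fock_vac \<in> cone_space B 0"
    using vac_supported zero_P supported_P_D vac_even by (auto simp: cone_space_def)
  show "cone_embedding s fock_vac = (fock_vac :: 'n fock)" for s
    using vac_supported zero_P by (intro cone_embedding_P) auto
qed (simp_all add: super_space_cone cone_Y_supported cone_embedding_mult cone_embedding_inj)

section \<open>The conformal vector on the cone space\<close>

lemma conformal_embedding: "cone_embedding s \<omega> = \<omega>"
  using conformal_supported zero_P by (intro cone_embedding_P) auto

text \<open>As \<open>\<omega>\<close> has support 0 and is fixed by \<open>theta\<close>, its
  action on both halves is the original one, and all weights stay unchanged.\<close>

lemma cone_Y_conformal:
  assumes "v \<in> fock_supported (lattice_points cone_D)"
  shows "cone_Y Y \<omega> n v = Y \<omega> n v"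
proof -
  have "\<omega> \<in> fock_supported LP"
    using conformal_supported zero_P by blast
  from fock_proj_sum[OF this, of 0]
  have "fock_proj LP \<omega> = \<omega>" "fock_proj LN \<omega> = 0"
    by (auto simp: fock.subspace_0[OF subspace_fock_supported])
  then have "cone_Y Y \<omega> n v = Y \<omega> n (fock_proj LP v + fock_proj LN v)"
    by (simp add: cone_Y_def Let_def theta_conformal Y_left Y_right)
  also have "fock_proj LP v + fock_proj LN v = v"
    using assms lattice_points_disjoint by (intro fock_proj_Un) (simp_all add: lattice_points_D)
  finally show ?thesis .
qed

lemma lookup_cone_conformal:
  assumes "v \<in> fock_supported (lattice_points cone_D)" "vir_mode (cone_Y Y) \<omega> 0 v = fock_scale h v"
    and "x \<in> Poly_Mapping.keys v"
  shows "h = of_rat (weight x)"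
  using lookup_conformal[of v x] assms
  by (simp add: vir_mode_def cone_Y_conformal lookup_fock_scale in_keys_iff)

theorem conformal_cone: "conformal_super_vertex_algebra fock_scale (cone_space B) (cone_Y Y) fock_vac \<omega>"
proof (rule cone.conformal_super_vertex_algebra_W)
  show "\<omega> \<in> cone_space B 0"
    using conformal_supported zero_P supported_P_D conformal_vector_even by (auto simp: cone_space_def)
  show "super_space (cone_space B) \<subseteq>
      fock.span {v \<in> super_space (cone_space B). \<exists>h. vir_mode (cone_Y Y) \<omega> 0 v = fock_scale h v}"
  proof
    fix v :: "'n fock"
    assume "v \<in> super_space (cone_space B)"
    then have "v \<in> fock_supported (lattice_points cone_D)"
      by (simp add: super_space_cone)
    then show "v \<in> fock.span {v \<in> super_space (cone_space B). \<exists>h. vir_mode (cone_Y Y) \<omega> 0 v = fock_scale h v}"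
    proof (rule fock_supported_hom[OF _ fock_hom_ident fock.subspace_span])
      fix s :: "('n \<times> nat) multiset" and \<alpha> :: "int ^ 'n"
      assume "\<alpha> \<in> lattice_points cone_D"
      then have D: "fock_basis (s, \<alpha>) \<in> fock_supported (lattice_points cone_D)"
        by (simp add: fock_basis_supported)
      then have "vir_mode (cone_Y Y) \<omega> 0 (fock_basis (s, \<alpha>)) = fock_scale (of_rat (weight (s, \<alpha>))) (fock_basis (s, \<alpha>))"
        by (simp add: vir_mode_def cone_Y_conformal conformal_weight)
      with D show "fock_basis (s, \<alpha>) \<in>
          fock.span {v \<in> super_space (cone_space B). \<exists>h. vir_mode (cone_Y Y) \<omega> 0 v = fock_scale h v}"
        by (intro fock.span_base) (auto simp: super_space_cone)
    qed
  qed
qed (use conformal_embedding virasoro_lattice translation_conformal in auto)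

end


section \<open>Finiteness\<close>

text \<open>Dickson's lemma, by induction on the set of coordinates: each further coordinate is made
  monotone by passing to a subsequence, which preserves what holds for the earlier ones.\<close>

lemma dickson:
  fixes f :: "nat \<Rightarrow> 'i::finite \<Rightarrow> nat"
  shows "\<exists>r :: nat \<Rightarrow> nat. strict_mono r \<and> (\<forall>i. mono (\<lambda>k. f (r k) i))"
proof -
  have "\<exists>r :: nat \<Rightarrow> nat. strict_mono r \<and> (\<forall>i\<in>A. mono (\<lambda>k. f (r k) i))" for A :: "'i set"
    using finite[of A]
  proof (induction A rule: finite_induct)
    case empty
    show ?case
      by (intro exI[of _ id]) (simp add: strict_mono_def)
  next
    case (insert i A)
    then obtain r :: "nat \<Rightarrow> nat" where r: "strict_mono r" "\<And>j. j \<in> A \<Longrightarrow> mono (\<lambda>k. f (r k) j)"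
      by blast
    obtain g where g: "strict_mono g" "monoseq (\<lambda>k. f (r (g k)) i)"
      using seq_monosub[of "\<lambda>k. f (r k) i"] by blast
    have "\<exists>h :: nat \<Rightarrow> nat. strict_mono h \<and> mono (\<lambda>k. f (r (g (h k))) i)"
    proof (cases "mono (\<lambda>k. f (r (g k)) i)")
      case True
      then show ?thesis
        by (intro exI[of _ id]) (simp add: strict_mono_def)
    next
      case False
      then have dec: "f (r (g n)) i \<le> f (r (g m)) i" if "m \<le> n" for m n
        using g(2) that unfolding monoseq_def mono_def by blast
      \<comment> \<open>A nonincreasing sequence of naturals is constant from the place where it
        attains its minimum.\<close>
      obtain N where N: "\<And>k. f (r (g N)) i \<le> f (r (g k)) i"
        using ex_has_least_nat[of "\<lambda>_. True" 0 "\<lambda>k. f (r (g k)) i"] by auto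
      have "f (r (g (N + k))) i = f (r (g N)) i" for k
        using dec[of N "N + k"] N[of "N + k"] by simp
      then show ?thesis
        by (intro exI[of _ "\<lambda>k. N + k"]) (simp add: strict_mono_def mono_def)
    qed
    then obtain h :: "nat \<Rightarrow> nat" where h: "strict_mono h" "mono (\<lambda>k. f (r (g (h k))) i)"
      by blast
    have gh: "strict_mono (\<lambda>k. g (h k))"
      using g(1) h(1) by (simp add: strict_mono_def)
    have "mono (\<lambda>k. f (r (g (h k))) j)" if "j \<in> A" for j
      using r(2)[OF that] strict_mono_mono[OF gh] by (simp add: mono_def)
    moreover have "strict_mono (\<lambda>k. r (g (h k)))"
      using r(1) gh by (simp add: strict_mono_def)
    ultimately show ?case
      using h(2) by (intro exI[of _ "\<lambda>k. r (g (h k))"]) auto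
  qed
  from this[of UNIV] show ?thesis
    by auto
qed

text \<open>Each element adds at least 1 and more than its second component, so both the size and
  the entries are bounded by \<open>K\<close>.\<close>

lemma finite_multisets_weight: "finite {s :: ('n::finite \<times> nat) multiset. (\<Sum>x\<in>#s. Suc (snd x)) \<le> K}"
proof (rule finite_subset)
  show "{s :: ('n \<times> nat) multiset. (\<Sum>x\<in>#s. Suc (snd x)) \<le> K} \<subseteq>
      mset ` {xs. set xs \<subseteq> UNIV \<times> {..K} \<and> length xs \<le> K}"
  proof
    fix s :: "('n \<times> nat) multiset"
    assume "s \<in> {s. (\<Sum>x\<in>#s. Suc (snd x)) \<le> K}"
    then have s: "(\<Sum>x\<in>#s. Suc (snd x)) \<le> K"
      by simp
    obtain xs where xs: "mset xs = s"
      using ex_mset by blast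
    have "size s \<le> (\<Sum>x\<in>#s. Suc (snd x))"
      by (induction s) auto
    moreover have "snd x \<le> (\<Sum>x\<in>#s. Suc (snd x))" if "x \<in># s" for x
      using that by (induction s) auto
    ultimately have "length xs \<le> K" "set xs \<subseteq> UNIV \<times> {..K}"
      using s xs by (force simp flip: size_mset set_mset_mset)+
    with xs show "s \<in> mset ` {xs. set xs \<subseteq> UNIV \<times> {..K} \<and> length xs \<le> K}"
      by blast
  qed
  show "finite (mset ` {xs :: ('n \<times> nat) list. set xs \<subseteq> UNIV \<times> {..K} \<and> length xs \<le> K})"
    by (intro finite_imageI finite_lists_length_le finite_cartesian_product) auto
qed

section \<open>Finiteness of the nonnegative lattice points of bounded length squared\<close>

context integral_lattice
begin

text \<open>
  If infinitely many points satisfied the bound, two of them, \<open>x \<le> y\<close>, would be congruent modulo a large \<open>M\<close>.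
  Then \<open>y - x\<close> has length squared at least \<open>M\<^sup>2\<close>, and the parallelogram law makes that of \<open>x + y\<close> negative.
\<close>

lemma finite_copositive:
  assumes pos: "\<And>\<alpha>. (\<And>i. 0 \<le> \<alpha> $ i) \<Longrightarrow> \<alpha> \<noteq> 0 \<Longrightarrow> 0 < B \<alpha> \<alpha>"
  shows "finite {\<alpha>. (\<forall>i. 0 \<le> \<alpha> $ i) \<and> B \<alpha> \<alpha> \<le> C}"
proof (rule ccontr)
  let ?S = "{\<alpha>. (\<forall>i. 0 \<le> \<alpha> $ i) \<and> B \<alpha> \<alpha> \<le> C}"
  assume inf: "infinite ?S"
  \<comment> \<open>The parallelogram law will bound \<open>M * M * B d d\<close> strictly by
    \<open>4 * C\<close>, so \<open>M * M\<close> must exceed \<open>4 * C\<close>; adding 1 also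
    keeps \<open>M\<close> positive.\<close>
  define M where "M = 4 * \<bar>C\<bar> + 1"
  then have "M \<le> M * M"
    using mult_right_mono[of 1 M M] by simp
  then have M: "M > 0" "4 * C < M * M"
    using M_def by linarith+
  \<comment> \<open>There are finitely many vectors of residues, so infinitely many points of
    \<open>?S\<close> share one.\<close>
  let ?res = "\<lambda>(\<alpha> :: int ^ 'n) i. \<alpha> $ i mod M"
  have "finite (?res ` ?S)"
  proof (rule finite_subset)
    show "?res ` ?S \<subseteq> PiE UNIV (\<lambda>_. {0..<M})"
      using M by auto
    show "finite (PiE (UNIV :: 'n set) (\<lambda>_. {0..<M}))"
      by (rule finite_PiE) auto
  qed
  then obtain \<alpha>0 where "infinite {\<alpha> \<in> ?S. ?res \<alpha> = ?res \<alpha>0}"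
    using pigeonhole_infinite[OF inf] by blast
  then obtain f :: "nat \<Rightarrow> int ^ 'n" where f: "inj f" "range f \<subseteq> {\<alpha> \<in> ?S. ?res \<alpha> = ?res \<alpha>0}"
    using infinite_countable_subset by blast
  then have nonneg: "0 \<le> f k $ i" and le: "B (f k) (f k) \<le> C" and res: "f k $ i mod M = \<alpha>0 $ i mod M" for k i
    by (auto simp: fun_eq_iff subset_iff)
  obtain r :: "nat \<Rightarrow> nat" where r: "strict_mono r" "\<And>i. mono (\<lambda>k. nat (f (r k) $ i))"
    using dickson[of "\<lambda>k i. nat (f k $ i)"] by blast
  define x y where "x = f (r 0)" and "y = f (r 1)"
  have "r 0 \<noteq> r 1"
    using r(1) by (metis strict_mono_eq zero_neq_one)
  then have "x \<noteq> y"
    using f(1) by (simp add: x_def y_def inj_eq)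
  have xy: "x $ i \<le> y $ i" "0 \<le> x $ i" "0 \<le> y $ i" for i
    using r(2)[of i] nonneg by (auto simp: x_def y_def mono_def nat_le_eq_zle dest!: spec[of _ 0] spec[of _ 1])
  define d :: "int ^ 'n" where "d = (\<chi> i. (y $ i - x $ i) div M)"
  have "M dvd y $ i - x $ i" for i
  proof -
    have "y $ i mod M = x $ i mod M"
      by (simp only: x_def y_def res)
    then show ?thesis
      by (simp add: mod_eq_dvd_iff)
  qed
  then have yd: "y = x + M *s d"
    by (simp add: vec_eq_iff d_def)
  then have "d \<noteq> 0"
    using \<open>x \<noteq> y\<close> by auto
  \<comment> \<open>Since \<open>x \<le> y\<close> in every coordinate, \<open>d\<close> is again a
    nonnegative lattice vector, and the positive integer \<open>B d d\<close> is at least 1.\<close>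
  then have "1 \<le> B d d"
    using pos[of d] xy M by (simp add: d_def pos_imp_zdiv_nonneg_iff int_one_le_iff_zero_less)
  then have "M * M * 1 \<le> M * M * B d d"
    using M by (intro mult_left_mono) auto
  moreover have "B (x + y) (x + y) + M * M * B d d = 2 * B x x + 2 * B y y"
  proof -
    have "M * M * B d d = B (M *s d) (M *s d)"
      by (simp only: B_scale_left B_sym[of d "M *s d"] mult.assoc)
    then show ?thesis
      by (simp only: yd B_add_left B_add_right B_sym[of "M *s d" x]) simp
  qed
  moreover have "B x x \<le> C" "B y y \<le> C"
    by (simp_all add: x_def y_def le)
  moreover have "0 < B (x + y) (x + y)"
  proof (rule pos)
    show "0 \<le> (x + y) $ i" for i
      using xy[of i] by simp
    show "x + y \<noteq> 0"
    proof
      assume "x + y = 0"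
      then have "x $ i + y $ i = 0" for i
        by (simp add: vec_eq_iff)
      then have "x $ i = y $ i" for i
        using xy[of i] by (smt (verit))
      with \<open>x \<noteq> y\<close> show False
        by (simp add: vec_eq_iff)
    qed
  qed
  ultimately show False
    using M by linarith
qed

end

section \<open>The vertex operator algebra property\<close>

context lattice_vertex
begin

text \<open>Twice the weight of a basis vector is an integer, and on the cone both its summands are
  nonnegative. This gives the lower bound 0 and, at a fixed weight, bounds the multiset and the
  lattice vector separately.\<close>

lemma vertex_operator_cone:
  assumes pos: "\<And>\<alpha>. \<alpha> \<in> lattice_points cone_D \<Longrightarrow> \<alpha> \<noteq> 0 \<Longrightarrow> 0 < B \<alpha> \<alpha>"
  shows "super_vertex_operator_algebra fock_scale (cone_space B) (cone_Y Y) fock_vac \<omega>"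
proof -
  interpret C: conformal_super_vertex_algebra fock_scale "cone_space B" "cone_Y Y" fock_vac \<omega>
    by (rule conformal_cone)
  have nonneg: "0 \<le> B \<alpha> \<alpha>" if "\<alpha> \<in> lattice_points cone_D" for \<alpha>
    using pos[OF that] by (cases "\<alpha> = 0") auto
  have eigen: "\<exists>x. snd x \<in> lattice_points cone_D \<and> h = of_rat (weight x)"
    if "v \<in> super_space (cone_space B)" "v \<noteq> 0" "vir_mode (cone_Y Y) \<omega> 0 v = fock_scale h v" for v h
  proof -
    obtain x where x: "x \<in> Poly_Mapping.keys v"
      using \<open>v \<noteq> 0\<close> by (metis all_not_in_conv keys_eq_empty)
    have "v \<in> fock_supported (lattice_points cone_D)"
      using that super_space_cone by blast
    with x that(3) show ?thesis
      by (metis lookup_cone_conformal fock_supported_keys prod.collapse)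
  qed
  have weight_half: "of_rat (weight x) = (of_int (2 * int (\<Sum>y\<in>#fst x. Suc (snd y)) + B (snd x) (snd x)) / 2 :: complex)" for x
  proof -
    have "of_rat (of_nat n + of_int k / 2) = (of_int (2 * int n + k) / 2 :: complex)" for n k
      by (simp add: of_rat_add of_rat_divide)
    then show ?thesis
      by (cases x) (simp only: weight_def prod.case fst_conv snd_conv)
  qed
  have finite_D: "finite {\<alpha> \<in> lattice_points cone_D. B \<alpha> \<alpha> \<le> C}" for C
  proof (rule finite_subset)
    let ?S = "{\<alpha>. (\<forall>i. 0 \<le> \<alpha> $ i) \<and> B \<alpha> \<alpha> \<le> C}"
    have "finite ?S"
      by (rule finite_copositive) (auto intro!: pos simp: lattice_points_D lattice_points_P)
    then show "finite (?S \<union> uminus ` ?S)"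
      by simp
    \<comment> \<open>Negation maps the points of \<open>LN\<close> into the nonnegative orthant and
      preserves the length squared.\<close>
    show "{\<alpha> \<in> lattice_points cone_D. B \<alpha> \<alpha> \<le> C} \<subseteq> ?S \<union> uminus ` ?S"
    proof
      fix \<alpha>
      assume \<alpha>: "\<alpha> \<in> {\<alpha> \<in> lattice_points cone_D. B \<alpha> \<alpha> \<le> C}"
      then consider "\<alpha> \<in> LP" | "\<alpha> \<in> LN"
        by (auto simp: lattice_points_D)
      then show "\<alpha> \<in> ?S \<union> uminus ` ?S"
      proof cases
        case 2
        then have "- \<alpha> \<in> ?S"
          using \<alpha> by (auto simp: lattice_points_N intro: less_imp_le)
        then have "- (- \<alpha>) \<in> uminus ` ?S"
          by (rule imageI)
        then show ?thesis
          by simp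
      qed (use \<alpha> in \<open>auto simp: lattice_points_P\<close>)
    qed
  qed
  show ?thesis
  proof unfold_locales
    show "\<exists>k::int. h = of_int k / 2"
      if "v \<in> super_space (cone_space B)" "v \<noteq> 0" "vir_mode (cone_Y Y) \<omega> 0 v = fock_scale h v" for v h
      using eigen[OF that] weight_half by metis
    show "\<exists>r::real. \<forall>v\<in>super_space (cone_space B). \<forall>h. v \<noteq> 0 \<and> vir_mode (cone_Y Y) \<omega> 0 v = fock_scale h v \<longrightarrow> r \<le> Re h"
    proof (intro exI[of _ 0] ballI allI impI)
      fix v h
      assume "v \<in> super_space (cone_space B)" "v \<noteq> 0 \<and> vir_mode (cone_Y Y) \<omega> 0 v = fock_scale h v"
      then obtain x where x: "snd x \<in> lattice_points cone_D" "h = of_rat (weight x)"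
        using eigen by blast
      define k where "k = 2 * int (\<Sum>y\<in>#fst x. Suc (snd y)) + B (snd x) (snd x)"
      have "0 \<le> k"
        unfolding k_def using nonneg[OF x(1)] by (intro add_nonneg_nonneg mult_nonneg_nonneg of_nat_0_le_iff) auto
      then show "0 \<le> Re h"
        unfolding x(2) weight_half k_def[symmetric] by simp
    qed
    fix h :: complex
    define A where "A = {x. snd x \<in> lattice_points cone_D \<and> h = of_rat (weight x)}"
    have "finite A"
    proof (cases "A = {}")
      case False
      then obtain x0 where x0: "h = of_rat (weight x0)"
        unfolding A_def by blast
      \<comment> \<open>Unless no basis vector has weight \<open>h\<close>, the integer
        \<open>C\<close> is twice that weight and bounds both summands for every element of
        \<open>A\<close>.\<close>
      define C where "C = 2 * int (\<Sum>y\<in>#fst x0. Suc (snd y)) + B (snd x0) (snd x0)"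
      have "A \<subseteq> {s. (\<Sum>x\<in>#s. Suc (snd x)) \<le> nat C} \<times> {\<alpha> \<in> lattice_points cone_D. B \<alpha> \<alpha> \<le> C}"
      proof
        fix x
        assume x: "x \<in> A"
        have half_inj: "of_int k / 2 = (of_int l / 2 :: complex) \<Longrightarrow> k = l" for k l
          by simp
        have eq: "2 * int (\<Sum>y\<in>#fst x. Suc (snd y)) + B (snd x) (snd x) = C"
          using x x0 unfolding C_def by (intro half_inj, unfold weight_half[symmetric]) (simp add: A_def)
        have D: "snd x \<in> lattice_points cone_D"
          using x unfolding A_def by blast
        have "(\<Sum>y\<in>#fst x. Suc (snd y)) \<le> nat C" "B (snd x) (snd x) \<le> C"
          using eq nonneg[OF D] by linarith+
        with D show "x \<in> {s. (\<Sum>x\<in>#s. Suc (snd x)) \<le> nat C} \<times> {\<alpha> \<in> lattice_points cone_D. B \<alpha> \<alpha> \<le> C}"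
          by (cases x) auto
      qed
      then show ?thesis
        by (rule finite_subset) (intro finite_cartesian_product finite_multisets_weight finite_D)
    qed simp
    moreover have "{v \<in> super_space (cone_space B). vir_mode (cone_Y Y) \<omega> 0 v = fock_scale h v} \<subseteq> fock.span (fock_basis ` A)"
    proof
      fix v
      assume v: "v \<in> {v \<in> super_space (cone_space B). vir_mode (cone_Y Y) \<omega> 0 v = fock_scale h v}"
      then have D: "v \<in> fock_supported (lattice_points cone_D)"
        by (simp add: super_space_cone)
      show "v \<in> fock.span (fock_basis ` A)"
      proof (rule fock_hom_mem[OF fock_hom_ident fock.subspace_span])
        fix x
        assume x: "x \<in> Poly_Mapping.keys v"
        have "x \<in> A"
          unfolding A_def using lookup_cone_conformal[OF D _ x] v fock_supported_keys[OF D, of "fst x" "snd x"] x by simp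
        then show "fock_basis x \<in> fock.span (fock_basis ` A)"
          by (intro fock.span_base imageI)
      qed
    qed
    ultimately show "\<exists>F. finite F \<and> {v \<in> super_space (cone_space B). vir_mode (cone_Y Y) \<omega> 0 v = fock_scale h v} \<subseteq> fock.span F"
      by (intro exI[of _ "fock_basis ` A"]) simp
  qed
qed

end

theorem theorem2p2:
  fixes B :: "int ^ 'n \<Rightarrow> int ^ 'n \<Rightarrow> int"
    and b :: "int ^ 'n \<Rightarrow> int ^ 'n \<Rightarrow> bit"
    and Y :: "'n fock \<Rightarrow> int \<Rightarrow> 'n fock \<Rightarrow> 'n fock"
  assumes "nondegenerate_integral_lattice B"
    and "lattice_cocycle B b"
    and "lattice_vertex_structure B b Y"
  shows "conformal_super_vertex_algebra fock_scale (cone_space B) (cone_Y Y) fock_vac (conformal_vector B)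
    \<and> (\<not> (\<exists>x\<in>cone_D. x \<noteq> 0 \<and> form_ext B x x \<le> 0) \<longrightarrow>
      super_vertex_operator_algebra fock_scale (cone_space B) (cone_Y Y) fock_vac (conformal_vector B))"
proof -
  interpret lattice_vertex B b Y
    by unfold_locales (fact assms)+
  \<comment> \<open>A nonzero lattice point of the cone is a nonzero rational point of it, and
    \<open>form_ext\<close> restricts to \<open>B\<close> there.\<close>
  have "0 < B \<alpha> \<alpha>"
    if "\<not> (\<exists>x\<in>cone_D. x \<noteq> 0 \<and> form_ext B x x \<le> 0)" "\<alpha> \<in> lattice_points cone_D" "\<alpha> \<noteq> 0" for \<alpha>
  proof -
    have "lattice_vec \<alpha> \<in> (cone_D :: (rat ^ 'n) set)" "lattice_vec \<alpha> \<noteq> (0 :: rat ^ 'n)"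
      using that(2,3) by (auto simp: lattice_points_def lattice_vec_def vec_eq_iff)
    with that(1) have "0 < (form_ext B (lattice_vec \<alpha>) (lattice_vec \<alpha>) :: rat)"
      by (meson not_less)
    then show ?thesis
      by (simp add: form_ext_lattice_vec)
  qed
  then show ?thesis
    using conformal_cone vertex_operator_cone by blast
qed

end
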